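(* Let $\Omega\subset\mathbb{R}^n$ be a closed, convex, semi-algebraic set and let $f,g:\mathbb{R}^n\to\mathbb{R}$ satisfy: (A1) $f$ and $g$ are both convex, semi-algebraic, Lipschitz continuous, and differentiable with Lipschitz continuous gradients over $\Omega$, and $g(x)>0$ for every $x\in\Omega$; (A2) for any $d\in\{f(x)/g(x)\mid x\in\Omega\}$, the level set $\{x\in\Omega\mid f(x)/g(x)\le d\}$ is bounded. Let $M\in\mathbb{R}$ be such that $f(x)-Mg(x)\ge 0$ for all $x\in\Omega$, let $\tilde f:=f-Mg$, let $L_{\nabla\tilde f}:=L_{\nabla f}+|M|L_{\nabla g}$, and let $F=\tilde f/g$ on $\Omega$, $F=+\infty$ outside $\Omega$. Let $\alpha\in\left(0,\frac{1}{L_{\nabla\tilde f}}\right)$, let $x^0\in\Omega$, and let $\{x^k\}_{k\in\mathbb{N}}$ be generated by PGA, i.e. for each $k\in\mathbb{N}$, $$c_k=\frac{\tilde f(x^k)}{g(x^k)},\qquad x^{k+1}=\mathrm{prox}_{\iota_\Omega}\big(x^k-\alpha\nabla\tilde f(x^k)+\alpha c_k\nabla g(x^k)\big).$$ Then $\{x^k\}_{k\in\mathbb{N}}$ converges to a critical point $x^*\in\Omega$ of $F$. Moreover, if $f(x^* )\le 0$, then $x^*$ is a globally optimal solution of $\min_{x\in\Omega}F(x)$, that is, a globally optimal solution of $\min_{x\in\Omega} f(x)/g(x)$.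
   Context: $\overline{\mathbb{R}}=\mathbb{R}\cup\{+\infty\}$; $\mathbb{N}$ is the set of nonnegative integers. $L_{\nabla f}$, $L_{\nabla g}$ denote Lipschitz constants on $\Omega$ of $\nabla f$, $\nabla g$. A set $\mathcal{S}\subset\mathbb{R}^n$ is semi-algebraic if $\mathcal{S}=\bigcup_{j=1}^s\bigcap_{i=1}^t\{x\mid p_{ij}(x)=0,\ q_{ij}(x)<0\}$ for real polynomials $p_{ij},q_{ij}$; a function $\psi:\mathcal{S}\to\overline{\mathbb{R}}$ is semi-algebraic if its graph $\{(x,y)\in\mathcal{S}\times\mathbb{R}\mid y=\psi(x)\}$ is a semi-algebraic subset of $\mathbb{R}^{n+1}$. $\iota_\Omega$ is the indicator function ($0$ on $\Omega$, $+\infty$ elsewhere). $\mathrm{prox}_\psi(x):=\mathrm{argmin}_{u\in\mathbb{R}^n}\{\frac12\|u-x\|_2^2+\psi(u)\}$; thus $\mathrm{prox}_{\iota_\Omega}$ is the Euclidean projection onto $\Omega$. For a proper lower semicontinuous $\psi:\mathbb{R}^n\to\overline{\mathbb{R}}$ and $x\in\mathrm{dom}\,\psi:=\{x\mid\psi(x)<+\infty\}$, the Fréchet subdifferential $\hat\partial\psi(x)$ is the set of $u$ with $\liminf_{y\to x,\,y\ne x}\frac{\psi(y)-\psi(x)-\langle u,y-x\rangle}{\|y-x\|_2}\ge 0$ (and $\hat\partial\psi(x)=\varnothing$ if $x\notin\mathrm{dom}\,\psi$). The (limiting) subdifferential is $\partial\psi(x):=\{u\mid \exists\, x^k\to x,\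 \psi(x^k)\to\psi(x),\ u^k\in\hat\partial\psi(x^k),\ u^k\to u\}$. $x$ is a critical point of $\psi$ if $0\in\partial\psi(x)$. *)

theory Defs
  imports "HOL-Analysis.Analysis"
begin

(* On a Euclidean space, real_polynomial_function describes exactly the polynomials in the
   coordinates: it is the closure of the linear functionals and the constants under sums and
   products. *)
definition semi_algebraic :: "'a::euclidean_space set \<Rightarrow> bool" where
  "semi_algebraic S \<longleftrightarrow>
    (\<exists>(s::nat) (t::nat) (p :: nat \<Rightarrow> nat \<Rightarrow> 'a \<Rightarrow> real) (q :: nat \<Rightarrow> nat \<Rightarrow> 'a \<Rightarrow> real).
      (\<forall>i j. real_polynomial_function (p i j) \<and> real_polynomial_function (q i j)) \<and>
      S = (\<Union>j\<in>{1..s}. \<Inter>i\<in>{1..t}. {x. p i j x = 0 \<and> q i j x < 0}))"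

(* The graph lies in S x R, so points where the function is infinite do not contribute. *)
definition semi_algebraic_fun_on :: "'a::euclidean_space set \<Rightarrow> ('a \<Rightarrow> ereal) \<Rightarrow> bool" where
  "semi_algebraic_fun_on S \<psi> \<longleftrightarrow>
    semi_algebraic {(x, y::real). x \<in> S \<and> ereal y = \<psi> x}"

(* Unspecified where f is not differentiable. *)
definition grad :: "('a::real_inner \<Rightarrow> real) \<Rightarrow> 'a \<Rightarrow> 'a" where
  "grad f x = (THE D. GDERIV f x :> D)"

definition set_indicator :: "'a set \<Rightarrow> 'a \<Rightarrow> ereal" where
  "set_indicator S x = (if x \<in> S then 0 else \<infinity>)"

(* The set of all minimisers; a singleton for the indicator of a nonempty closed convex set. *)
definition prox :: "('a::real_inner \<Rightarrow> ereal) \<Rightarrow> 'a \<Rightarrow> 'a set" where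
  "prox \<psi> x =
    {u. is_arg_min (\<lambda>u. ereal (1/2 * (norm (u - x))\<^sup>2) + \<psi> u) (\<lambda>u. u \<in> UNIV) u}"

definition effective_dom :: "('a \<Rightarrow> ereal) \<Rightarrow> 'a set" where
  "effective_dom \<psi> = {x. \<psi> x < \<infinity>}"

definition frechet_subdiff :: "('a::real_inner \<Rightarrow> ereal) \<Rightarrow> 'a \<Rightarrow> 'a set" where
  "frechet_subdiff \<psi> x =
    (if x \<in> effective_dom \<psi>
     then {u. Liminf (at x)
                (\<lambda>y. (\<psi> y - \<psi> x - ereal (inner u (y - x))) / ereal (norm (y - x))) \<ge> 0}
     else {})"

definition limiting_subdiff :: "('a::real_inner \<Rightarrow> ereal) \<Rightarrow> 'a \<Rightarrow> 'a set" where
  "limiting_subdiff \<psi> x =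
    (if x \<in> effective_dom \<psi>
     then {u. \<exists>xs us. xs \<longlonglongrightarrow> x \<and> (\<lambda>k. \<psi> (xs k)) \<longlonglongrightarrow> \<psi> x \<and>
                (\<forall>k::nat. us k \<in> frechet_subdiff \<psi> (xs k)) \<and> us \<longlonglongrightarrow> u}
     else {})"

definition critical_point :: "('a::real_inner \<Rightarrow> ereal) \<Rightarrow> 'a \<Rightarrow> bool" where
  "critical_point \<psi> x \<longleftrightarrow> 0 \<in> limiting_subdiff \<psi> x"

end

theory Submission
  imports Defs
begin

text \<open>The projection step and the convexity of \<open>g\<close> give sufficient decrease
  \<open>F (x k) - F (x (k + 1)) \<ge> a * norm (x (k + 1) - x k)^2\<close>, so the iterates stay in a compact convex
  piece \<open>K\<close> of \<open>\<Omega>\<close>; the optimality condition of the projection bounds the steepness of \<open>F\<close> on \<open>K\<close> at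
  \<open>x (k + 1)\<close> by a multiple of \<open>norm (x (k + 1) - x k)\<close>. Such a sequence has finite length by a
  Kurdyka--Lojasiewicz inequality: minimising the steepness on each level of \<open>F\<close> selects a
  semi-algebraic curve, whose coordinates are continuous and monotone near the critical level, and
  its variation serves as desingularising function. That semi-algebraic conditions are closed under
  quantifiers is Muchnik's argument: in a family of polynomials closed under derivatives,
  pseudo-remainders and truncation, the signs of the constants determine the order of all roots.
  In the limit \<open>F\<close> has a minimum up to a quadratic error at the limit point, which makes it critical,
  and which convexity of \<open>f - (f x / g x) g\<close> turns into a global minimum if \<open>f x \<le> 0\<close>.\<close>

section \<open>Matching the roots of two univariate polynomials\<close>

text \<open>Both deep ingredients, quantifier elimination and the Kurdyka--Lojasiewicz inequality,
  are brought down to one real variable. For the first the obstacle is that a polynomial with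
  parameters has no fixed degree: its leading coefficient may vanish at some of them. Lists with a
  formal degree, together with their truncations, absorb this. For the second the obstacle is the
  constraint, which makes \<open>F\<close> nonsmooth at the boundary of \<open>\<Omega>\<close>; the
  slope is therefore a formula that only compares values of \<open>F\<close>, with a quadratic error
  term paid for by the Lipschitz gradients. Along a continuous curve this error is of second order
  in the increments and is absorbed. The sign of the ratio matters twice, in opposite directions.
  Sufficient decrease multiplies the tangent inequality of \<open>g\<close> by \<open>c k\<close>
  and wants \<open>c k \<ge> 0\<close>, which the shift by \<open>M\<close> provides; the final step
  wants the unshifted ratio to be nonpositive, so that a nonnegative multiple of \<open>g\<close> is
  added to \<open>f\<close>.\<close>

lemma extend_strict_mono:
  fixes \<sigma> :: "real \<Rightarrow> real"
  assumes "finite A" "strict_mono_on A \<sigma>"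
  shows "\<exists>h. strict_mono h \<and> surj h \<and> (\<forall>a\<in>A. h a = \<sigma> a)"
  using assms
proof (induction rule: finite_linorder_max_induct)
  case empty
  show ?case by (rule exI[of _ id]) (auto simp: strict_mono_def)
next
  case (insert b A)
  have "strict_mono_on A \<sigma>"
    using insert.prems by (auto simp: strict_mono_on_def)
  then obtain h where h: "strict_mono h" "surj h" "\<And>a. a \<in> A \<Longrightarrow> h a = \<sigma> a"
    using insert.IH by blast
  show ?case
  proof (cases "A = {}")
    case True
    show ?thesis
      by (rule exI[of _ "\<lambda>t. t - b + \<sigma> b"]) (auto simp: True strict_mono_def intro!: surjI[of _ "\<lambda>t. t + b - \<sigma> b"])
  next
    case False
    define a where "a = Max A"
    have aA: "a \<in> A" and amax: "\<And>x. x \<in> A \<Longrightarrow> x \<le> a"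
      using False insert.hyps by (auto simp: a_def)
    have ab: "a < b" using aA insert.hyps by auto
    have sab: "\<sigma> a < \<sigma> b" using insert.prems aA ab by (auto simp: strict_mono_on_def)
    define k where "k = (\<sigma> b - \<sigma> a) / (b - a)"
    have k: "k > 0" using ab sab by (auto simp: k_def)
    \<comment> \<open>The inserted \<open>b\<close> is the new maximum, so everything right of
      \<open>a\<close> may be replaced: \<open>k\<close> is the slope of the line through
      \<open>(a, \<sigma> a)\<close> and \<open>(b, \<sigma> b)\<close>.\<close>
    define h' where "h' = (\<lambda>t. if t \<le> a then h t else \<sigma> a + k * (t - a))"
    have ha: "h a = \<sigma> a" using h(3) aA by auto
    have le: "h t \<le> \<sigma> a \<longleftrightarrow> t \<le> a" for t
      using h(1) ha by (metis strict_mono_less_eq)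
    have "strict_mono h'"
    proof (rule strict_monoI)
      fix s t :: real assume st: "s < t"
      show "h' s < h' t"
      proof (cases "t \<le> a")
        case True then show ?thesis using st h(1) by (auto simp: h'_def strict_mono_less)
      next
        case False
        then have pos: "k * (t - a) > 0" using k by auto
        show ?thesis
        proof (cases "s \<le> a")
          case True
          then have "h s \<le> \<sigma> a" using le by blast
          then have "h s < \<sigma> a + k * (t - a)" using pos by linarith
          then show ?thesis using True False by (simp add: h'_def)
        next
          case semialg_pred: False
          have "k * (s - a) < k * (t - a)" using st k by simp
          then show ?thesis using semialg_pred False by (simp add: h'_def)
        qed
      qed
    qed
    moreover have "surj h'"
    proof -
      have "\<exists>t. y = h' t" for y
      proof (cases "y \<le> \<sigma> a")
        case True
        obtain t where t: "y = h t" using h(2) by (metis surjD)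
        then have "t \<le> a" using le True by simp
        then show ?thesis using t by (auto simp: h'_def)
      next
        case False
        have "(y - \<sigma> a) / k > 0" using False k by auto
        then show ?thesis using k by (intro exI[of _ "a + (y - \<sigma> a) / k"]) (auto simp: h'_def)
      qed
      then show ?thesis by (auto simp: surj_def)
    qed
    moreover have "\<forall>x\<in>insert b A. h' x = \<sigma> x"
      using ab amax h(3) by (auto simp: h'_def k_def)
    ultimately show ?thesis by blast
  qed
qed

section \<open>Signs of a real polynomial near infinity and away from its roots\<close>

lemma poly_sgn_at_top:
  fixes p :: "real poly"
  assumes "p \<noteq> 0"
  shows "\<exists>B. \<forall>t\<ge>B. sgn (poly p t) = sgn (lead_coeff p)"
proof (cases "lead_coeff p > 0")
  case True
  then show ?thesis using poly_pinfty_gt_lc[OF True] by (metis order_less_le_trans sgn_pos)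
next
  case False
  then have "lead_coeff (-p) > 0" using assms by (simp add: less_le)
  from poly_pinfty_gt_lc[OF this] obtain B where "\<And>t. t \<ge> B \<Longrightarrow> poly (-p) t \<ge> lead_coeff (-p)"
    by blast
  with \<open>lead_coeff (-p) > 0\<close> have "\<And>t. t \<ge> B \<Longrightarrow> poly p t < 0" by force
  then show ?thesis using \<open>lead_coeff (-p) > 0\<close> by (metis lead_coeff_minus neg_0_less_iff_less sgn_neg)
qed

lemma poly_sgn_at_bot:
  fixes p :: "real poly"
  assumes "p \<noteq> 0"
  shows "\<exists>B. \<forall>t\<le>B. sgn (poly p t) = sgn (lead_coeff p) * (-1) ^ degree p"
proof -
  let ?q = "pcompose p [:0,-1:]"
  have "?q \<noteq> 0" using assms by (simp add: pcompose_eq_0_iff)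
  then obtain B where B: "\<And>t. t \<ge> B \<Longrightarrow> sgn (poly ?q t) = sgn (lead_coeff ?q)"
    using poly_sgn_at_top by blast
  have "lead_coeff ?q = lead_coeff p * (-1) ^ degree p"
    by (simp add: lead_coeff_comp)
  then have "sgn (lead_coeff ?q) = sgn (lead_coeff p) * (-1) ^ degree p"
    by (cases "even (degree p)") (auto simp: sgn_mult)
  then show ?thesis using B[of "- t" for t] by (intro exI[of _ "-B"]) (auto simp: poly_pcompose)
qed

lemma poly_sgn_const:
  fixes p :: "real poly"
  assumes "\<And>r. min s t \<le> r \<Longrightarrow> r \<le> max s t \<Longrightarrow> poly p r \<noteq> 0"
  shows "sgn (poly p s) = sgn (poly p t)"
proof -
  have *: "sgn (poly p s) = sgn (poly p t)" if "s < t" "\<And>r. s \<le> r \<Longrightarrow> r \<le> t \<Longrightarrow> poly p r \<noteq> 0" for s t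
  proof (rule ccontr)
    assume ne: "sgn (poly p s) \<noteq> sgn (poly p t)"
    have "poly p s \<noteq> 0" "poly p t \<noteq> 0" using that by auto
    then have "poly p s * poly p t < 0" using ne by (auto simp: sgn_if mult_less_0_iff split: if_splits)
    then show False using poly_IVT[OF that(1)] that(2) by force
  qed
  consider "s < t" | "s = t" | "t < s" by linarith
  then show ?thesis
  proof cases
    case 1
    show ?thesis by (rule *[OF 1]) (use assms 1 in auto)
  next
    case 3
    show ?thesis by (rule *[OF 3, symmetric]) (use assms 3 in auto)
  qed simp
qed

lemma poly_strict_mono_between:
  fixes p :: "real poly"
  assumes "s < t" "\<And>r. s < r \<Longrightarrow> r < t \<Longrightarrow> sgn (poly (pderiv p) r) = e" "e \<noteq> 0"
  shows "sgn (poly p t - poly p s) = e"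
proof -
  obtain r where "s < r" "r < t" "poly p t - poly p s = (t - s) * poly (pderiv p) r"
    using poly_MVT[OF assms(1)] by blast
  then show ?thesis using assms by (simp add: sgn_mult)
qed

lemma finite_bracket:
  fixes Z :: "real set"
  assumes "finite Z" "t \<notin> Z" "a0 \<in> Z" "a0 < t" "b0 \<in> Z" "t < b0"
  obtains a b where "a \<in> Z" "b \<in> Z" "a < t" "t < b" "\<And>c. c \<in> Z \<Longrightarrow> c \<le> a \<or> b \<le> c"
proof -
  define a where "a = Max {c\<in>Z. c < t}"
  define b where "b = Min {c\<in>Z. t < c}"
  have 1: "a \<in> {c\<in>Z. c < t}" "b \<in> {c\<in>Z. t < c}"
    unfolding a_def b_def using assms by (intro Max_in Min_in; auto)+
  have "c \<le> a \<or> b \<le> c" if "c \<in> Z" for c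
  proof (cases "c < t")
    case True then show ?thesis using that assms by (auto simp: a_def)
  next
    case False then have "t < c" using that assms by (metis linorder_neqE)
    then show ?thesis using that assms by (auto simp: b_def)
  qed
  then show ?thesis using that 1 by auto
qed

text \<open>The polynomials \<open>P\<close> and \<open>Q\<close> are strictly monotone in the same direction on corresponding
  gaps of \<open>Z\<close> and have equal signs at corresponding points of \<open>Z\<close>, so the intermediate value
  theorem matches their roots.\<close>

lemma match_roots:
  fixes P Q :: "real poly"
  assumes h: "strict_mono h" "surj h" and Z: "finite Z"
    and P': "\<And>t. poly (pderiv P) t = 0 \<Longrightarrow> t \<in> Z"
    and sgn': "\<And>t. sgn (poly (pderiv P) t) = sgn (poly (pderiv Q) (h t))"
    and sgnZ: "\<And>t. t \<in> Z \<Longrightarrow> sgn (poly P t) = sgn (poly Q (h t))"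
    and nz: "P \<noteq> 0" "Q \<noteq> 0"
    and deg: "degree P = degree Q" "sgn (lead_coeff P) = sgn (lead_coeff Q)"
  shows "\<exists>h'. strict_mono h' \<and> surj h' \<and> (\<forall>t\<in>Z. h' t = h t) \<and>
           (\<forall>t. sgn (poly P t) = sgn (poly Q (h' t)))"
proof -
  obtain B1 B2 B3 B4 where
    B1: "\<And>t. t \<ge> B1 \<Longrightarrow> sgn (poly P t) = sgn (lead_coeff P)" and
    B2: "\<And>t. t \<ge> B2 \<Longrightarrow> sgn (poly Q t) = sgn (lead_coeff Q)" and
    B3: "\<And>t. t \<le> B3 \<Longrightarrow> sgn (poly P t) = sgn (lead_coeff P) * (-1) ^ degree P" and
    B4: "\<And>t. t \<le> B4 \<Longrightarrow> sgn (poly Q t) = sgn (lead_coeff Q) * (-1) ^ degree Q"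
    using nz poly_sgn_at_top poly_sgn_at_bot by metis
  obtain u2 u4 where u: "h u2 = B2" "h u4 = B4" using h(2) by (metis surjD)
  \<comment> \<open>From \<open>b0\<close> upwards and from \<open>a0\<close> downwards both
    polynomials have the signs of their leading terms. Adding these ends to \<open>Z\<close> makes
    every relevant gap bounded. The inserted 0 covers an empty \<open>Z\<close>, and
    \<open>b0 - 1\<close> keeps the ends apart.\<close>
  define b0 where "b0 = max (max B1 u2) (Max (insert 0 Z))"
  define a0 where "a0 = min (min (min B3 u4) (b0 - 1)) (Min (insert 0 Z))"
  have ab0: "a0 < b0" by (auto simp: a0_def)
  have hmono: "h s < h t \<longleftrightarrow> s < t" "h s \<le> h t \<longleftrightarrow> s \<le> t" for s t
    using h(1) by (auto simp: strict_mono_less strict_mono_less_eq)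
  have top: "sgn (poly P t) = sgn (lead_coeff P)" "sgn (poly Q (h t)) = sgn (lead_coeff Q)"
    if "t \<ge> b0" for t
    using B1[of t] B2[of "h t"] hmono(2)[of u2 t] u that by (auto simp: b0_def)
  have bot: "sgn (poly P t) = sgn (lead_coeff P) * (-1) ^ degree P"
      "sgn (poly Q (h t)) = sgn (lead_coeff Q) * (-1) ^ degree Q"
    if "t \<le> a0" for t
    using B3[of t] B4[of "h t"] hmono(2)[of t u4] u that by (auto simp: a0_def)
  define W where "W = insert a0 (insert b0 Z)"
  have W: "finite W" "a0 \<in> W" "b0 \<in> W" using Z by (auto simp: W_def)
  have P'W: "poly (pderiv P) t = 0 \<Longrightarrow> t \<in> W" for t using P' by (auto simp: W_def)
  have sgnW: "sgn (poly P t) = sgn (poly Q (h t))" if "t \<in> W" for t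
    using that sgnZ top[of b0] bot[of a0] deg by (auto simp: W_def)
  have out: "sgn (poly P t) = sgn (poly Q s)" if "t \<le> a0 \<and> s \<le> h a0 \<or> t \<ge> b0 \<and> s \<ge> h b0" for s t
  proof -
    obtain s' where "s = h s'" using h(2) by (metis surjD)
    then show ?thesis using that top(1)[of t] top(2)[of s'] bot(1)[of t] bot(2)[of s'] deg hmono by auto
  qed
  have gap: "\<exists>e. e \<noteq> 0 \<and> (\<forall>s t. a \<le> s \<and> s < t \<and> t \<le> b \<longrightarrow> sgn (poly P t - poly P s) = e) \<and>
        (\<forall>s t. h a \<le> s \<and> s < t \<and> t \<le> h b \<longrightarrow> sgn (poly Q t - poly Q s) = e)"
    if ab: "a \<in> W" "b \<in> W" "a < b" "\<And>c. c \<in> W \<Longrightarrow> c \<le> a \<or> b \<le> c" for a b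
  proof -
    define m where "m = (a + b) / 2"
    have m: "a < m" "m < b" using ab by (auto simp: m_def)
    define e where "e = sgn (poly (pderiv P) m)"
    have nr: "poly (pderiv P) r \<noteq> 0" if "a < r" "r < b" for r
      using P'W ab that by force
    have e: "e \<noteq> 0" using nr m by (auto simp: e_def sgn_0_0)
    have 1: "sgn (poly (pderiv P) r) = e" if "a < r" "r < b" for r
      unfolding e_def by (rule poly_sgn_const) (use nr that m in \<open>auto simp: min_def max_def split: if_splits\<close>)
    have 2: "sgn (poly (pderiv Q) r) = e" if "h a < r" "r < h b" for r
    proof -
      obtain r' where r': "r = h r'" using h(2) by (metis surjD)
      then show ?thesis using 1[of r'] sgn'[of r'] that hmono by auto
    qed
    show ?thesis
      by (rule exI[of _ e]) (auto simp: e intro!: poly_strict_mono_between 1 2)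
  qed
  define R where "R = {t. poly P t = 0}"
  have R: "finite R" unfolding R_def using nz by (simp add: poly_roots_finite)
  \<comment> \<open>\<open>s\<close> lies among the points \<open>h c\<close> as \<open>r\<close>
    lies among the points \<open>c\<close> of \<open>W\<close>. Any choice of such roots is order
    preserving: between two roots of \<open>P\<close> there is a root of its derivative, which
    belongs to \<open>W\<close>.\<close>
  define good where "good r s \<longleftrightarrow> poly Q s = 0 \<and> (\<forall>c\<in>W. (c < r \<longleftrightarrow> h c < s) \<and> (r < c \<longleftrightarrow> s < h c))" for r s
  have ex: "\<exists>s. good r s" if r: "r \<in> R" "r \<notin> W" for r
  proof -
    have Pr: "poly P r = 0" using r by (simp add: R_def)
    have "a0 < r"
    proof (rule ccontr)
      assume "\<not> a0 < r"
      then have "sgn (poly P r) = sgn (lead_coeff P) * (-1) ^ degree P" using bot by auto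
      then show False using Pr nz by (simp add: sgn_0_0)
    qed
    moreover have "r < b0"
    proof (rule ccontr)
      assume "\<not> r < b0"
      then have "sgn (poly P r) = sgn (lead_coeff P)" using top by auto
      then show False using Pr nz by (simp add: sgn_0_0)
    qed
    ultimately obtain a b where ab: "a \<in> W" "b \<in> W" "a < r" "r < b" "\<And>c. c \<in> W \<Longrightarrow> c \<le> a \<or> b \<le> c"
      using finite_bracket[OF W(1) r(2) W(2) _ W(3)] by blast
    then obtain e where e: "e \<noteq> 0" "\<And>s t. a \<le> s \<and> s < t \<and> t \<le> b \<Longrightarrow> sgn (poly P t - poly P s) = e"
      using gap[of a b] by force
    have "sgn (- poly P a) = e" "sgn (poly P b) = e" using e(2)[of a r] e(2)[of r b] ab Pr by auto
    then have "sgn (poly Q (h a)) = - e" "sgn (poly Q (h b)) = e" using sgnW ab by (auto simp: sgn_minus)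
    then have "poly Q (h a) * poly Q (h b) < 0" using e(1)
      by (auto simp: sgn_if mult_less_0_iff split: if_splits)
    then obtain s where s: "h a < s" "s < h b" "poly Q s = 0"
      using poly_IVT[of "h a" "h b" Q] hmono ab by auto
    have "(c < r \<longleftrightarrow> h c < s) \<and> (r < c \<longleftrightarrow> s < h c)" if "c \<in> W" for c
      using ab(5)[OF that]
    proof
      assume "c \<le> a"
      then have "h c \<le> h a" using hmono by auto
      then show ?thesis using \<open>c \<le> a\<close> s ab by auto
    next
      assume "b \<le> c"
      then have "h b \<le> h c" using hmono by auto
      then show ?thesis using \<open>b \<le> c\<close> s ab by auto
    qed
    then show ?thesis using s by (auto simp: good_def)
  qed
  define \<sigma> where "\<sigma> r = (if r \<in> W then h r else SOME s. good r s)" for r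
  have good: "good r (\<sigma> r)" if "r \<in> R" "r \<notin> W" for r
    using ex[OF that] that by (auto simp: \<sigma>_def intro: someI)
  have "strict_mono_on (W \<union> R) \<sigma>"
  proof (rule strict_mono_onI)
    fix r s assume rs: "r \<in> W \<union> R" "s \<in> W \<union> R" "r < s"
    show "\<sigma> r < \<sigma> s"
    proof (cases "r \<in> W")
      case True
      have "\<sigma> r = h r" using True by (simp add: \<sigma>_def)
      moreover have "h r < \<sigma> s"
      proof (cases "s \<in> W")
        case True then show ?thesis using rs hmono by (simp add: \<sigma>_def)
      next
        case False then show ?thesis using good[of s] \<open>r \<in> W\<close> rs by (auto simp: good_def)
      qed
      ultimately show ?thesis by simp
    next
      case False
      then have rR: "r \<in> R" using rs by auto
      show ?thesis
      proof (cases "s \<in> W")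
        case True
        then show ?thesis using good[OF rR False] rs by (auto simp: good_def \<sigma>_def)
      next
        case sW: False
        then have sR: "s \<in> R" using rs by auto
        obtain c where c: "r < c" "c < s" "poly P s - poly P r = (s - r) * poly (pderiv P) c"
          using poly_MVT[OF rs(3)] by blast
        then have "c \<in> W" using rR sR P'W[of c] by (auto simp: R_def)
        then have "\<sigma> r < h c" "h c < \<sigma> s"
          using good[OF rR False] good[OF sR sW] c by (auto simp: good_def)
        then show ?thesis by simp
      qed
    qed
  qed
  then obtain h' where h': "strict_mono h'" "surj h'" "\<And>a. a \<in> W \<union> R \<Longrightarrow> h' a = \<sigma> a"
    using extend_strict_mono[of "W \<union> R" \<sigma>] W R by auto
  have h'W: "h' t = h t" if "t \<in> W" for t using that h'(3) by (simp add: \<sigma>_def)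
  have h'mono: "h' s < h' t \<longleftrightarrow> s < t" "h' s \<le> h' t \<longleftrightarrow> s \<le> t" for s t
    using h'(1) by (auto simp: strict_mono_less strict_mono_less_eq)
  have "sgn (poly P t) = sgn (poly Q (h' t))" for t
  proof (cases "t \<in> W \<union> R")
    case True
    then show ?thesis
      using sgnW[of t] h'W[of t] good[of t] h'(3)[of t] by (cases "t \<in> W") (auto simp: R_def good_def)
  next
    case tW: False
    then have Pt: "poly P t \<noteq> 0" by (auto simp: R_def)
    show ?thesis
    proof (cases "t \<le> a0 \<or> t \<ge> b0")
      case True
      then show ?thesis using out[of t "h' t"] h'W W h'mono(2)[of t a0] h'mono(2)[of b0 t] by auto
    next
      case False
      then obtain a b where ab: "a \<in> W" "b \<in> W" "a < t" "t < b" "\<And>c. c \<in> W \<Longrightarrow> c \<le> a \<or> b \<le> c"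
        using finite_bracket[OF W(1) _ W(2) _ W(3)] tW by (metis UnI1 linorder_not_le)
      then obtain e where e: "e \<noteq> 0"
        "\<And>s t. a \<le> s \<and> s < t \<and> t \<le> b \<Longrightarrow> sgn (poly P t - poly P s) = e"
        "\<And>s t. h a \<le> s \<and> s < t \<and> t \<le> h b \<Longrightarrow> sgn (poly Q t - poly Q s) = e"
        using gap[of a b] by force
      have ht: "h a < h' t" "h' t < h b"
        using h'W ab h'mono(1)[of a t] h'mono(1)[of t b] by auto
      \<comment> \<open>The sign at \<open>t\<close> is forced by one reference point
        \<open>c\<close> in the same closed gap: going right from \<open>c\<close> moves the value
        in direction \<open>e\<close>, going left in direction \<open>- e\<close>, and the sign at
        \<open>c\<close> is zero or already the right one. Position and sign of \<open>c\<close>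
        survive \<open>h'\<close>, so \<open>Q\<close> is treated alike.\<close>
      have key: "\<exists>c. a \<le> c \<and> c \<le> b \<and> (if x then c < t else t < c) \<and> c \<in> W \<union> R \<and>
          (if x then sgn (poly P c) \<in> {0, e} else sgn (poly P c) \<in> {0, - e})"
        if x: "x \<longleftrightarrow> sgn (poly P t) = e" for x
      proof (cases x)
        case True
        show ?thesis
        proof (cases "sgn (poly P a) \<in> {0, e}")
          case True then show ?thesis using \<open>x\<close> ab by (intro exI[of _ a]) auto
        next
          case False
          then have "poly P a * poly P t < 0" using Pt e(1) x \<open>x\<close>
            by (auto simp: sgn_if mult_less_0_iff split: if_splits)
          then obtain c where "a < c" "c < t" "poly P c = 0" using poly_IVT[of a t P] ab by auto
          then show ?thesis using \<open>x\<close> ab by (intro exI[of _ c]) (auto simp: R_def)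
        qed
      next
        case nx: False
        have "e = 1 \<or> e = -1" using e(1) e(2)[of a b] ab by (auto simp: sgn_if split: if_splits)
        then have st: "sgn (poly P t) = - e" using Pt x nx by (auto simp: sgn_if split: if_splits)
        show ?thesis
        proof (cases "sgn (poly P b) \<in> {0, -e}")
          case True then show ?thesis using nx ab by (intro exI[of _ b]) auto
        next
          case False
          then have "poly P t * poly P b < 0" using Pt e(1) st
            by (auto simp: sgn_if mult_less_0_iff split: if_splits)
          then obtain c where "t < c" "c < b" "poly P c = 0" using poly_IVT[of t b P] ab by auto
          then show ?thesis using nx ab by (intro exI[of _ c]) (auto simp: R_def)
        qed
      qed
      have sgnc: "sgn (poly P c) = sgn (poly Q (h' c))" if "c \<in> W \<union> R" for c
        using sgnW[of c] h'W[of c] good[of c] h'(3)[of c] that by (cases "c \<in> W") (auto simp: R_def good_def)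
      have e1: "e = 1 \<or> e = -1" using e(1) e(2)[of a b] ab by (auto simp: sgn_if split: if_splits)
      define x where "x \<longleftrightarrow> sgn (poly P t) = e"
      obtain c where c: "a \<le> c" "c \<le> b" "if x then c < t else t < c" "c \<in> W \<union> R"
        "if x then sgn (poly P c) \<in> {0, e} else sgn (poly P c) \<in> {0, - e}"
        using key[OF x_def] by blast
      have hc: "h a \<le> h' c" "h' c \<le> h b" using h'W[OF ab(1)] h'W[OF ab(2)] h'mono(2)[of a c] h'mono(2)[of c b] c(1,2) by auto
      show ?thesis
      proof (cases x)
        case True
        then have "sgn (poly Q (h' t) - poly Q (h' c)) = e"
          using e(3)[of "h' c" "h' t"] c hc ht h'mono by auto
        then show ?thesis using True c sgnc[OF c(4)] e1 by (auto simp: x_def sgn_if split: if_splits)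
      next
        case False
        then have "sgn (poly Q (h' c) - poly Q (h' t)) = e"
          using e(3)[of "h' t" "h' c"] c hc ht h'mono by auto
        moreover have "sgn (poly P t) = - e" using Pt False e1 by (auto simp: x_def sgn_if split: if_splits)
        ultimately show ?thesis using False c sgnc[OF c(4)] e1 by (auto simp: sgn_if split: if_splits)
      qed
    qed
  qed
  moreover have "\<forall>t\<in>Z. h' t = h t" using h'W by (simp add: W_def)
  ultimately show ?thesis using h'(1,2) by blast
qed

section \<open>Sign transfer in closed families of parametric polynomials\<close>

text \<open>A list \<open>L\<close> of real functions on a parameter space stands for the polynomial in one variable
  with these functions as coefficients; its formal degree is \<open>length L - 1\<close>.\<close>

definition poly_at :: "('z \<Rightarrow> real) list \<Rightarrow> 'z \<Rightarrow> real poly" where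
  "poly_at L z = Poly (map (\<lambda>c. c z) L)"

definition formal_pderiv :: "('z \<Rightarrow> real) list \<Rightarrow> ('z \<Rightarrow> real) list" where
  "formal_pderiv L = map (\<lambda>i z. real (Suc i) * (L ! Suc i) z) [0..<length L - 1]"

text \<open>The factor \<open>(last q)\<^sup>2\<close> makes the reduction sign preserving at the roots of \<open>q\<close>.\<close>

definition reduce_lead :: "('z \<Rightarrow> real) list \<Rightarrow> ('z \<Rightarrow> real) list \<Rightarrow> ('z \<Rightarrow> real) list" where
  "reduce_lead p q = map (\<lambda>i z. last q z * last q z * (p ! i) z -
     (if i < length p - length q then 0
      else last p z * last q z * (q ! (i - (length p - length q))) z)) [0..<length p - 1]"

lemma length_reduce_lead [simp]: "length (reduce_lead p q) = length p - 1"
  by (simp add: reduce_lead_def)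

text \<open>The recursion follows formal lengths and steps even where \<open>last q\<close>
  vanishes, so that one list serves all parameters. As a remainder it is interpreted only at
  parameters with \<open>last q z \<noteq> 0\<close>.\<close>

function prem :: "('z \<Rightarrow> real) list \<Rightarrow> ('z \<Rightarrow> real) list \<Rightarrow> ('z \<Rightarrow> real) list" where
  "prem p q = (if q = [] \<or> length p < length q then p else prem (reduce_lead p q) q)"
  by pat_completeness auto
termination
proof (relation "Wellfounded.measure (\<lambda>(p, q). length p)", goal_cases)
  case (2 p q)
  then have "0 < length p" by (cases p) auto
  then show ?case by simp
qed simp

declare prem.simps [simp del]

lemma coeff_poly_at: "coeff (poly_at L z) i = (if i < length L then (L ! i) z else 0)"
  by (simp add: poly_at_def nth_default_def)

lemma poly_at_Nil [simp]: "poly_at [] z = 0"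
  by (simp add: poly_at_def)

lemma poly_at_single [simp]: "poly_at [c] z = [:c z:]"
  by (simp add: poly_at_def)

text \<open>Parameters at which the formal leading coefficient vanishes are handled by the truncated
  list.\<close>

lemma poly_at_butlast: "last L z = 0 \<Longrightarrow> poly_at (butlast L) z = poly_at L z"
  by (cases "L = []")
     (auto intro!: poly_eqI simp: coeff_poly_at nth_butlast last_conv_nth less_Suc_eq
       dest!: less_antisym)

lemma degree_poly_at:
  assumes "L \<noteq> []" "last L z \<noteq> 0"
  shows "degree (poly_at L z) = length L - 1" "lead_coeff (poly_at L z) = last L z"
proof -
  have c: "coeff (poly_at L z) (length L - 1) = last L z"
    using assms by (simp add: coeff_poly_at last_conv_nth)
  show d: "degree (poly_at L z) = length L - 1"
  proof (rule antisym)
    show "degree (poly_at L z) \<le> length L - 1"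
      by (rule degree_le) (auto simp: coeff_poly_at)
    show "length L - 1 \<le> degree (poly_at L z)"
      by (rule le_degree) (use c assms in auto)
  qed
  show "lead_coeff (poly_at L z) = last L z" using c d by simp
qed

lemma poly_at_formal_pderiv: "poly_at (formal_pderiv L) z = pderiv (poly_at L z)"
  by (rule poly_eqI) (auto simp: coeff_poly_at coeff_pderiv formal_pderiv_def)

lemma poly_at_reduce_lead:
  assumes "q \<noteq> []" "length q \<le> length p"
  shows "poly_at (reduce_lead p q) z =
    smult ((last q z)\<^sup>2) (poly_at p z) -
    monom (last p z * last q z) (length p - length q) * poly_at q z"
proof (rule poly_eqI)
  fix i
  have p: "p \<noteq> []" using assms by auto
  consider "i < length p - 1" | "i = length p - 1" | "i \<ge> length p" by linarith
  then show "coeff (poly_at (reduce_lead p q) z) i =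
    coeff (smult ((last q z)\<^sup>2) (poly_at p z) -
    monom (last p z * last q z) (length p - length q) * poly_at q z) i"
  proof cases
    case 1
    then have "i - (length p - length q) < length q" "i < length p"
      using assms by (cases q; auto)+
    then show ?thesis using 1
      by (simp add: coeff_poly_at coeff_monom_mult reduce_lead_def power2_eq_square)
  next
    \<comment> \<open>The top coefficient cancels by construction, which is why
      \<open>reduce_lead\<close> leaves it out.\<close>
    case 2
    then have "i - (length p - length q) = length q - 1" "\<not> i < length p - length q"
      using assms p by (cases p; cases q; auto)+
    then show ?thesis using 2 p assms
      by (auto simp add: coeff_poly_at coeff_monom_mult last_conv_nth power2_eq_square)
  next
    case 3
    then show ?thesis using assms by (auto simp: coeff_poly_at coeff_monom_mult)
  qed
qed

lemma length_prem: "q \<noteq> [] \<Longrightarrow> length (prem p q) < length q"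
  by (induction p q rule: prem.induct) (subst prem.simps, auto)

lemma prem_short: "length p < length q \<Longrightarrow> prem p q = p"
  by (simp add: prem.simps)

text \<open>At a root of \<open>q\<close> the subtracted multiple vanishes, and each reduction
  scales the value by a positive square. Thus the sign of \<open>p\<close> at a root of
  \<open>q\<close> is read off a list shorter than \<open>q\<close>.\<close>

lemma sgn_prem:
  assumes "q \<noteq> []" "last q z \<noteq> 0" "poly (poly_at q z) t = 0"
  shows "sgn (poly (poly_at (prem p q) z) t) = sgn (poly (poly_at p z) t)"
  using assms
proof (induction p q rule: prem.induct)
  case (1 p q)
  show ?case
  proof (cases "length p < length q")
    case False
    have "sgn (poly (poly_at (prem p q) z) t) = sgn (poly (poly_at (reduce_lead p q) z) t)"
      using 1 False by (subst prem.simps) auto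
    also have "\<dots> = sgn (poly (poly_at p z) t)"
    proof -
      have "(sgn (last q z))\<^sup>2 = 1" using 1 by (simp add: sgn_if)
      then show ?thesis using 1 False by (simp add: poly_at_reduce_lead sgn_mult)
    qed
    finally show ?thesis .
  qed (simp add: prem_short)
qed

definition poly_coeffs :: "('z::euclidean_space \<Rightarrow> real) list \<Rightarrow> bool" where
  "poly_coeffs L \<longleftrightarrow> (\<forall>c\<in>set L. real_polynomial_function c)"

lemma real_polynomial_function_const: "real_polynomial_function (\<lambda>z. c)"
  by (rule real_polynomial_function.intros)

lemma real_polynomial_function_mult:
  "real_polynomial_function f \<Longrightarrow> real_polynomial_function g \<Longrightarrow> real_polynomial_function (\<lambda>z. f z * g z)"
  by (rule real_polynomial_function.intros)

lemma poly_coeffs_prem: "poly_coeffs p \<Longrightarrow> poly_coeffs q \<Longrightarrow> poly_coeffs (prem p q)"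
proof (induction p q rule: prem.induct)
  case (1 p q)
  show ?case
  proof (cases "q = [] \<or> length p < length q")
    case True then show ?thesis using 1 by (subst prem.simps) auto
  next
    case False
    then have ne: "p \<noteq> []" "q \<noteq> []" by auto
    have "poly_coeffs (reduce_lead p q)"
      unfolding poly_coeffs_def
    proof
      fix c assume "c \<in> set (reduce_lead p q)"
      then obtain i where i: "i < length p - 1" "c = (\<lambda>z. last q z * last q z * (p ! i) z -
         (if i < length p - length q then 0
          else last p z * last q z * (q ! (i - (length p - length q))) z))"
        by (auto simp: reduce_lead_def)
      have "i - (length p - length q) < length q" using i(1) False ne by (cases q; auto)
      then have *: "real_polynomial_function (last q)" "real_polynomial_function (last p)"
        "real_polynomial_function (p ! i)" "real_polynomial_function (q ! (i - (length p - length q)))"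
        using 1(2,3) ne i(1) by (auto simp: poly_coeffs_def)
      show "real_polynomial_function c" unfolding i(2)
        by (cases "i < length p - length q"; simp only: if_True if_False;
            intro real_polynomial_function_diff real_polynomial_function_mult
              real_polynomial_function_const *)
    qed
    then show ?thesis using 1 False by (subst prem.simps) auto
  qed
qed

lemma poly_coeffs_formal_pderiv: "poly_coeffs L \<Longrightarrow> poly_coeffs (formal_pderiv L)"
  unfolding formal_pderiv_def poly_coeffs_def
  by (auto intro!: real_polynomial_function_mult[OF real_polynomial_function_const])

text \<open>\<open>[last p]\<close> records the leading coefficient as a constant of the family. At
  \<open>n = 1\<close> only lists of length at most one are exempt, which are constant in the
  variable and cannot be reduced further.\<close>

definition closed_above :: "nat \<Rightarrow> ('z \<Rightarrow> real) list set \<Rightarrow> bool" where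
  "closed_above n S \<longleftrightarrow>
    (\<forall>p\<in>S. n < length p \<longrightarrow> [last p] \<in> S \<and> butlast p \<in> S \<and> formal_pderiv p \<in> S) \<and>
    (\<forall>p\<in>S. \<forall>q\<in>S. n < length p \<longrightarrow> n < length q \<longrightarrow> prem p q \<in> S)"

text \<open>The operations on lists longer than \<open>n\<close> yield known lists or lists of length at most \<open>n\<close>,
  so that closing a family downwards terminates.\<close>

lemma closed_above_extend:
  fixes S :: "('z::euclidean_space \<Rightarrow> real) list set"
  assumes "finite S" "\<forall>L\<in>S. poly_coeffs L" "closed_above n S" "1 \<le> n"
  shows "\<exists>T. S \<subseteq> T \<and> finite T \<and> (\<forall>L\<in>T. poly_coeffs L) \<and> closed_above 1 T"
  using assms(4,1,2,3)
proof (induction n arbitrary: S rule: dec_induct)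
  case base
  then show ?case by blast
next
  case (step n)
  define B where "B = {p\<in>S. n < length p}"
  define N where "N = (\<lambda>p. [last p]) ` B \<union> butlast ` B \<union> formal_pderiv ` B \<union> (\<lambda>(p, q). prem p q) ` (B \<times> B)"
  have long: "L \<in> S" if "L \<in> N" "n < length L" for L
  proof -
    have *: "\<lbrakk>p \<in> S; Suc n < length p\<rbrakk> \<Longrightarrow> [last p] \<in> S \<and> butlast p \<in> S \<and> formal_pderiv p \<in> S"
      "\<lbrakk>p \<in> S; q \<in> S; Suc n < length p; Suc n < length q\<rbrakk> \<Longrightarrow> prem p q \<in> S" for p q
      using step.prems by (auto simp: closed_above_def)
    \<comment> \<open>A remainder longer than \<open>n\<close> forces
      \<open>length q > Suc n\<close>. If \<open>p\<close> has length exactly \<open>Suc n\<close>,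
      it is shorter than \<open>q\<close> and is its own remainder; otherwise closedness above
      \<open>Suc n\<close> applies.\<close>
    have "prem p q \<in> S" if "p \<in> B" "q \<in> B" "n < length (prem p q)" for p q
    proof -
      have "Suc n < length q" using that length_prem[of q p] by (cases "q = []") (auto simp: B_def)
      then show ?thesis
        using that *(2)[of p q] prem_short[of p q] by (cases "length p = Suc n") (auto simp: B_def)
    qed
    moreover have "Suc n < length p" if "p \<in> B" "n < length p - 1" for p using that by auto
    ultimately show ?thesis using that *(1) step.hyps by (auto simp: N_def B_def formal_pderiv_def)
  qed
  have "finite (S \<union> N)" using step.prems by (auto simp: N_def B_def)
  moreover have "\<forall>L\<in>S \<union> N. poly_coeffs L"
  proof -
    have B: "poly_coeffs L" "L \<noteq> []" if "L \<in> B" for L using that step.prems by (auto simp: B_def)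
    have "poly_coeffs [last L]" "poly_coeffs (butlast L)" if "L \<in> B" for L
      using B[OF that] by (auto simp: poly_coeffs_def dest: in_set_butlastD)
    note ops = this poly_coeffs_formal_pderiv[OF B(1)] poly_coeffs_prem[OF B(1) B(1)]
    have "poly_coeffs L" if LN: "L \<in> N" for L
    proof -
      show ?thesis using LN unfolding N_def
        by (elim UnE imageE) (auto simp: ops)
    qed
    then show ?thesis using step.prems(2) by blast
  qed
  moreover have "closed_above n (S \<union> N)"
  proof -
    have B: "p \<in> B" if "p \<in> S \<union> N" "n < length p" for p using that long by (auto simp: B_def)
    have N: "[last p] \<in> N" "butlast p \<in> N" "formal_pderiv p \<in> N" if "p \<in> B" for p
      using that by (simp_all add: N_def)
    have "(\<lambda>(p, q). prem p q) (p, q) \<in> N" if "p \<in> B" "q \<in> B" for p q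
      unfolding N_def by (rule UnI2, rule imageI) (use that in simp)
    then have N': "prem p q \<in> N" if "p \<in> B" "q \<in> B" for p q using that by simp
    show ?thesis unfolding closed_above_def
      by (intro conjI ballI impI; rule UnI2; rule N N'; rule B; assumption)
  qed
  ultimately obtain T where "S \<union> N \<subseteq> T" "finite T" "\<forall>L\<in>T. poly_coeffs L" "closed_above 1 T"
    using step.IH[of "S \<union> N"] by blast
  then show ?case by blast
qed

lemma closed_above_1_superset:
  fixes S :: "('z::euclidean_space \<Rightarrow> real) list set"
  assumes "finite S" "\<forall>L\<in>S. poly_coeffs L"
  shows "\<exists>T. S \<subseteq> T \<and> finite T \<and> (\<forall>L\<in>T. poly_coeffs L) \<and> closed_above 1 T"
proof -
  have "length L \<le> Suc (\<Sum>L\<in>S. length L)" if "L \<in> S" for L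
    using member_le_sum[OF that, of length] assms by auto
  then have "closed_above (Suc (\<Sum>L\<in>S. length L)) S"
    by (auto simp: closed_above_def dest: leD)
  then show ?thesis using closed_above_extend[OF assms] by fastforce
qed

lemma sgn_eq_0: "sgn a = sgn b \<Longrightarrow> a = 0 \<longleftrightarrow> b = (0::real)"
  by (metis sgn_0_0)

text \<open>Muchnik's form of quantifier elimination: in a closed family the signs of the constants
  determine the order type of all the roots together with all the signs.\<close>

lemma sign_transfer:
  fixes S :: "('z \<Rightarrow> real) list set"
  assumes S: "finite S" "closed_above 1 S"
    and const: "\<And>c. [c] \<in> S \<Longrightarrow> sgn (c z) = sgn (c w)"
    and "H \<subseteq> S" "\<And>p q. p \<in> H \<Longrightarrow> q \<in> S \<Longrightarrow> length q < length p \<Longrightarrow> q \<in> H"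
  shows "\<exists>h::real\<Rightarrow>real. strict_mono h \<and> surj h \<and>
    (\<forall>p\<in>H. \<forall>t. sgn (poly (poly_at p z) t) = sgn (poly (poly_at p w) (h t)))"
  using assms(4,5)
proof (induction "card H" arbitrary: H)
  case 0
  then have "H = {}" using S finite_subset by fastforce
  then show ?case by (intro exI[of _ id]) (auto simp: strict_mono_def)
next
  case (Suc n)
  have fin: "finite H" using Suc.prems S finite_subset by blast
  \<comment> \<open>Removing a longest list keeps the downward closure, and everything shorter that
    is derived from it remains in \<open>H'\<close>.\<close>
  have "H \<noteq> {}" using Suc.hyps by auto
  then have "Max (length ` H) \<in> length ` H" using fin by (intro Max_in) auto
  then obtain p where p: "p \<in> H" "length p = Max (length ` H)" by auto
  then have p: "p \<in> H" "\<And>q. q \<in> H \<Longrightarrow> length q \<le> length p"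
    using fin by auto
  have pS: "p \<in> S" using p Suc.prems by auto
  define H' where "H' = H - {p}"
  have card: "n = card H'" using Suc.hyps fin p by (simp add: H'_def)
  have H'S: "H' \<subseteq> S" using Suc.prems by (auto simp: H'_def)
  have low: "q \<in> H'" if "q \<in> S" "length q < length p" for q
    using that Suc.prems(2)[OF p(1)] by (auto simp: H'_def)
  have "q' \<in> H'" if "q \<in> H'" "q' \<in> S" "length q' < length q" for q q'
    using that p(2)[of q] Suc.prems(2)[of q q'] by (auto simp: H'_def)
  then obtain h where h: "strict_mono h" "surj h"
    and hsgn: "\<And>q t. q \<in> H' \<Longrightarrow> sgn (poly (poly_at q z) t) = sgn (poly (poly_at q w) (h t))"
    using Suc.hyps(1)[OF card H'S] by blast
  have hmono: "h s < h t \<longleftrightarrow> s < t" for s t using h(1) by (simp add: strict_mono_less)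
  have done_if: ?case if "\<forall>t. sgn (poly (poly_at p z) t) = sgn (poly (poly_at p w) (h t))"
    using h hsgn that by (intro exI[of _ h]) (auto simp: H'_def)
  consider "length p = 0" | "length p = 1" | "1 < length p" by linarith
  then show ?case
  proof cases
    case 1
    then show ?thesis by (intro done_if) auto
  next
    case 2
    then obtain c where "p = [c]" by (metis One_nat_def length_0_conv length_Suc_conv)
    then show ?thesis using const pS by (intro done_if) auto
  next
    case 3
    then have pne: "p \<noteq> []" by auto
    have cl: "[last p] \<in> S" "butlast p \<in> S" "formal_pderiv p \<in> S"
      using S(2) pS 3 by (auto simp: closed_above_def)
    have H'ops: "butlast p \<in> H'" "formal_pderiv p \<in> H'"
      using cl 3 by (auto intro!: low simp: formal_pderiv_def)
    have lastsgn: "sgn (last p z) = sgn (last p w)" using const cl by blast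
    show ?thesis
    proof (cases "last p z = 0")
      case True
      then have "last p w = 0" using sgn_eq_0[OF lastsgn] by simp
      then show ?thesis
        using True hsgn[OF H'ops(1)] poly_at_butlast[of p z] poly_at_butlast[of p w]
        by (intro done_if) auto
    next
      case False
      then have lw: "last p w \<noteq> 0" using sgn_eq_0[OF lastsgn] by simp
      note degz = degree_poly_at[OF pne False] and degw = degree_poly_at[OF pne lw]
      \<comment> \<open>Lists that vanish identically at \<open>z\<close> are excluded, since they
        would make \<open>Z\<close> infinite.\<close>
      define Z where "Z = (\<Union>q\<in>{q\<in>H'. poly_at q z \<noteq> 0}. {t. poly (poly_at q z) t = 0})"
      have Z: "finite Z" unfolding Z_def
        using fin by (auto simp: H'_def poly_roots_finite)
      have "\<exists>h'. strict_mono h' \<and> surj h' \<and> (\<forall>t\<in>Z. h' t = h t) \<and>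
           (\<forall>t. sgn (poly (poly_at p z) t) = sgn (poly (poly_at p w) (h' t)))"
      proof (rule match_roots[OF h Z])
        show "sgn (poly (pderiv (poly_at p z)) t) = sgn (poly (pderiv (poly_at p w)) (h t))" for t
          using hsgn[OF H'ops(2)] by (simp add: poly_at_formal_pderiv)
        show "t \<in> Z" if "poly (pderiv (poly_at p z)) t = 0" for t
        proof -
          have "pderiv (poly_at p z) \<noteq> 0" using degz 3 by (simp add: pderiv_eq_0_iff)
          then show ?thesis using that H'ops(2) by (auto simp: Z_def simp flip: poly_at_formal_pderiv)
        qed
        show "sgn (poly (poly_at p z) t) = sgn (poly (poly_at p w) (h t))" if "t \<in> Z" for t
        proof -
          \<comment> \<open>A shortest \<open>q\<close> vanishing at \<open>t\<close> without being
            zero at \<open>z\<close> has \<open>last q z \<noteq> 0\<close>, as otherwise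
            \<open>butlast q\<close> would be a shorter one. Hence \<open>prem p q\<close>, which is
            in \<open>H'\<close>, has the sign of \<open>p\<close> at \<open>t\<close>, and likewise
            for \<open>w\<close> at \<open>h t\<close>.\<close>
          define good where "good q \<longleftrightarrow> q \<in> H' \<and> poly_at q z \<noteq> 0 \<and> poly (poly_at q z) t = 0" for q
          have "\<exists>q. good q" using that by (auto simp: Z_def good_def)
          then obtain q where q: "good q" "\<And>q'. good q' \<Longrightarrow> length q \<le> length q'"
            using ex_has_least_nat[of good _ length] by blast
          have qH: "q \<in> H'" "q \<in> S" "length q \<le> length p" using q H'S p(2) by (auto simp: good_def H'_def)
          have l2: "1 < length q"
          proof (rule ccontr)
            assume "\<not> 1 < length q"
            then have "q = [] \<or> (\<exists>c. q = [c])" by (metis One_nat_def Suc_lessI length_0_conv length_Suc_conv neq0_conv)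
            then show False using q(1) by (auto simp: good_def)
          qed
          then have qne: "q \<noteq> []" by auto
          have clq: "[last q] \<in> S" "butlast q \<in> S" "prem p q \<in> S"
            using S(2) qH pS l2 3 by (auto simp: closed_above_def)
          have qz: "last q z \<noteq> 0"
          proof
            assume "last q z = 0"
            then have "good (butlast q)"
              using q(1) clq(2) qH l2 poly_at_butlast[of q z] by (auto simp: good_def intro!: low)
            then show False using q(2)[of "butlast q"] l2 by auto
          qed
          then have qw: "last q w \<noteq> 0" using const[OF clq(1)] sgn_eq_0 by metis
          have z0: "poly (poly_at q z) t = 0" using q by (simp add: good_def)
          then have w0: "poly (poly_at q w) (h t) = 0" using hsgn[OF qH(1), of t] by (simp add: sgn_0_0)
          have "prem p q \<in> H'" using clq(3) length_prem[OF qne, of p] qH(3) by (intro low) auto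
          then show ?thesis
            using sgn_prem[OF qne qz z0, of p] sgn_prem[OF qne qw w0, of p] hsgn by metis
        qed
        show "poly_at p z \<noteq> 0" "poly_at p w \<noteq> 0" using degz degw 3 by auto
        show "degree (poly_at p z) = degree (poly_at p w)" using degz degw by simp
        show "sgn (lead_coeff (poly_at p z)) = sgn (lead_coeff (poly_at p w))"
          using degz degw lastsgn by simp
      qed
      then obtain h' where h': "strict_mono h'" "surj h'" "\<And>t. t \<in> Z \<Longrightarrow> h' t = h t"
        "\<And>t. sgn (poly (poly_at p z) t) = sgn (poly (poly_at p w) (h' t))" by blast
      have h'mono: "h' s < h' t \<longleftrightarrow> s < t" for s t using h'(1) by (simp add: strict_mono_less)
      have hn: "h' t \<noteq> h c" if "t \<notin> Z" "c \<in> Z" for t c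
        using that h'(1,3) by (metis strict_mono_eq)
      have "sgn (poly (poly_at q z) t) = sgn (poly (poly_at q w) (h' t))" if q: "q \<in> H'" for q t
      proof (cases "t \<in> Z")
        case True
        then show ?thesis using hsgn[OF q] h'(3) by simp
      next
        case tZ: False
        show ?thesis
        proof (cases "poly_at q z = 0")
          case True
          then have "poly (poly_at q w) (h s) = 0" for s using hsgn[OF q, of s] by (simp add: sgn_0_0)
          then have "poly (poly_at q w) s = 0" for s using h(2) by (metis surjD)
          then show ?thesis using True by simp
        next
          case False
          \<comment> \<open>Off \<open>Z\<close> the maps \<open>h\<close> and \<open>h'\<close> may
            differ, but they send \<open>t\<close> into the same gap between the images of points of
            \<open>Z\<close>, and every root of \<open>q\<close> at \<open>w\<close> is such an
            image.\<close>
          have "sgn (poly (poly_at q w) (h t)) = sgn (poly (poly_at q w) (h' t))"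
          proof (rule poly_sgn_const)
            fix r assume r: "min (h t) (h' t) \<le> r" "r \<le> max (h t) (h' t)"
            obtain c where c: "r = h c" using h(2) by (metis surjD)
            show "poly (poly_at q w) r \<noteq> 0"
            proof
              assume "poly (poly_at q w) r = 0"
              then have "poly (poly_at q z) c = 0" using hsgn[OF q, of c] c by (simp add: sgn_0_0)
              then have cZ: "c \<in> Z" using q False by (auto simp: Z_def)
              have "c \<noteq> t" using cZ tZ by auto
              then consider "c < t" | "t < c" by linarith
              then show False
              proof cases
                case 1
                then have "h c < h t" "h c < h' t" using hmono h'mono[of c t] h'(3)[OF cZ] by auto
                then show False using r c by auto
              next
                case 2
                then have "h t < h c" "h' t < h c" using hmono h'mono[of t c] h'(3)[OF cZ] by auto
                then show False using r c by auto
              qed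
            qed
          qed
          then show ?thesis using hsgn[OF q] by simp
        qed
      qed
      then have "\<forall>q\<in>H. \<forall>t. sgn (poly (poly_at q z) t) = sgn (poly (poly_at q w) (h' t))"
        using h'(4) by (metis DiffI H'_def singletonD)
      then show ?thesis using h'(1,2) by blast
    qed
  qed
qed

section \<open>Quantifier elimination\<close>

text \<open>A semi-algebraic condition is one that depends only on the signs of finitely many polynomials.
  In this form quantifier elimination amounts to a transfer of signs.\<close>

definition semialg_pred :: "('a::euclidean_space \<Rightarrow> bool) \<Rightarrow> bool" where
  "semialg_pred P \<longleftrightarrow> (\<exists>S. finite S \<and> (\<forall>p\<in>S. real_polynomial_function p) \<and>
    (\<forall>x y. (\<forall>p\<in>S. sgn (p x) = sgn (p y)) \<longrightarrow> P x = P y))"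

definition semialg_fun :: "('a::euclidean_space \<Rightarrow> 'b::euclidean_space) \<Rightarrow> bool" where
  "semialg_fun u \<longleftrightarrow> semialg_pred (\<lambda>z. snd z = u (fst z))"

lemma saI:
  assumes "finite S" "\<And>p. p \<in> S \<Longrightarrow> real_polynomial_function p"
    "\<And>x y. (\<And>p. p \<in> S \<Longrightarrow> sgn (p x) = sgn (p y)) \<Longrightarrow> P x = P y"
  shows "semialg_pred P"
  unfolding semialg_pred_def
proof (intro exI conjI ballI allI impI)
  show "finite S" by (rule assms(1))
  show "real_polynomial_function p" if "p \<in> S" for p using that by (rule assms(2))
  show "P x = P y" if "\<forall>p\<in>S. sgn (p x) = sgn (p y)" for x y
    by (rule assms(3)) (use that in simp)
qed

lemma semialg_Not:
  assumes "semialg_pred P" shows "semialg_pred (\<lambda>x. \<not> P x)"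
proof -
  obtain S where S': "finite S" "\<forall>p\<in>S. real_polynomial_function p"
      "\<forall>x y. (\<forall>p\<in>S. sgn (p x) = sgn (p y)) \<longrightarrow> P x = P y"
    using assms unfolding semialg_pred_def by (elim exE conjE)
  note S = S'(1) bspec[OF S'(2)] S'(3)[rule_format]
  show ?thesis by (rule saI[OF S(1,2)]) (use S(3) in blast)+
qed

lemma semialg_conj:
  assumes "semialg_pred P" "semialg_pred Q" shows "semialg_pred (\<lambda>x. P x \<and> Q x)"
proof -
  obtain S where S': "finite S" "\<forall>p\<in>S. real_polynomial_function p"
      "\<forall>x y. (\<forall>p\<in>S. sgn (p x) = sgn (p y)) \<longrightarrow> P x = P y"
    using assms(1) unfolding semialg_pred_def by (elim exE conjE)
  note S = S'(1) bspec[OF S'(2)] S'(3)[rule_format]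
  obtain T where T': "finite T" "\<forall>p\<in>T. real_polynomial_function p"
      "\<forall>x y. (\<forall>p\<in>T. sgn (p x) = sgn (p y)) \<longrightarrow> Q x = Q y"
    using assms(2) unfolding semialg_pred_def by (elim exE conjE)
  note T = T'(1) bspec[OF T'(2)] T'(3)[rule_format]
  show ?thesis
  proof (rule saI)
    show "finite (S \<union> T)" using S(1) T(1) by simp
    show "real_polynomial_function p" if "p \<in> S \<union> T" for p using that S(2) T(2) by (elim UnE)
    show "(P x \<and> Q x) = (P y \<and> Q y)" if "\<And>p. p \<in> S \<union> T \<Longrightarrow> sgn (p x) = sgn (p y)" for x y
      using S(3)[of x y] T(3)[of x y] that by simp
  qed
qed

lemma semialg_disj: "semialg_pred P \<Longrightarrow> semialg_pred Q \<Longrightarrow> semialg_pred (\<lambda>x. P x \<or> Q x)"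
  using semialg_Not[OF semialg_conj[OF semialg_Not[of P] semialg_Not[of Q]]] by simp

lemma semialg_imp: "semialg_pred P \<Longrightarrow> semialg_pred Q \<Longrightarrow> semialg_pred (\<lambda>x. P x \<longrightarrow> Q x)"
  unfolding imp_conv_disj by (intro semialg_disj semialg_Not)

lemma semialg_const: "semialg_pred (\<lambda>x. b)"
  unfolding semialg_pred_def by (rule exI[of _ "{}"]) auto

lemma semialg_pos: "real_polynomial_function p \<Longrightarrow> semialg_pred (\<lambda>x. 0 < p x)"
  unfolding semialg_pred_def by (rule exI[of _ "{p}"]) (auto simp: sgn_if split: if_splits)

lemma semialg_eq_0: "real_polynomial_function p \<Longrightarrow> semialg_pred (\<lambda>x. p x = 0)"
  unfolding semialg_pred_def by (rule exI[of _ "{p}"]) (auto simp: sgn_if split: if_splits)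

lemma semialg_compose:
  assumes "semialg_pred P" "polynomial_function u" shows "semialg_pred (\<lambda>x. P (u x))"
proof -
  obtain S where S': "finite S" "\<forall>p\<in>S. real_polynomial_function p"
      "\<forall>x y. (\<forall>p\<in>S. sgn (p x) = sgn (p y)) \<longrightarrow> P x = P y"
    using assms(1) unfolding semialg_pred_def by (elim exE conjE)
  note S = S'(1) bspec[OF S'(2)] S'(3)[rule_format]
  show ?thesis
  proof (rule saI)
    show "finite ((\<lambda>p. p \<circ> u) ` S)" using S(1) by simp
    show "real_polynomial_function q" if "q \<in> (\<lambda>p. p \<circ> u) ` S" for q
      using that S(2) real_polynomial_function_compose[OF assms(2)] by (elim imageE) simp
    show "P (u x) = P (u y)" if "\<And>q. q \<in> (\<lambda>p. p \<circ> u) ` S \<Longrightarrow> sgn (q x) = sgn (q y)" for x y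
    proof (rule S(3))
      fix p assume "p \<in> S"
      then show "sgn (p (u x)) = sgn (p (u y))" using that[of "p \<circ> u"] by simp
    qed
  qed
qed

lemma real_polynomial_function_on_line:
  fixes b :: "'a::euclidean_space"
  assumes "real_polynomial_function p"
  shows "\<exists>L. poly_coeffs L \<and> (\<forall>z t. p (z + t *\<^sub>R b) = poly (poly_at L z) t)"
proof -
  \<comment> \<open>The degree bound is uniform in \<open>z\<close>; it turns the varying
    polynomials \<open>q z\<close> into one list of coefficient functions.\<close>
  have "\<exists>q n. (\<forall>z. degree (q z) \<le> n) \<and> (\<forall>i. real_polynomial_function (\<lambda>z. coeff (q z) i)) \<and>
      (\<forall>z t. p (z + t *\<^sub>R b) = poly (q z) t)"
    using assms
  proof (induction p rule: real_polynomial_function.induct)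
    case (linear f)
    have lin: "f (z + t *\<^sub>R b) = f z + t * f b" for z t
      using bounded_linear.linear[OF linear] by (simp add: linear_add linear_cmul)
    have "real_polynomial_function (\<lambda>z. coeff [:f z, f b:] i)" for i
    proof -
      consider "i = 0" | "i = 1" | "i \<ge> 2" by linarith
      then show ?thesis
      proof cases
        case 3
        then have "coeff [:f z, f b:] i = 0" for z by (intro coeff_eq_0) auto
        then show ?thesis by (simp add: real_polynomial_function_const)
      qed (simp_all add: real_polynomial_function.intros(1)[OF linear] real_polynomial_function_const)
    qed
    then show ?case
      by (intro exI[of _ "\<lambda>z. [:f z, f b:]"] exI[of _ 1]) (auto simp: lin)
  next
    case (const c)
    have "real_polynomial_function (\<lambda>z::'a. coeff [:c:] i)" for i
      by (rule real_polynomial_function_const)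
    then show ?case
      by (intro exI[of _ "\<lambda>z. [:c:]"] exI[of _ 0]) auto
  next
    case (add f g)
    then obtain q n q' n' where *:
      "\<And>z. degree (q z) \<le> n" "\<And>i. real_polynomial_function (\<lambda>z. coeff (q z) i)" "\<And>z t. f (z + t *\<^sub>R b) = poly (q z) t"
      "\<And>z. degree (q' z) \<le> n'" "\<And>i. real_polynomial_function (\<lambda>z. coeff (q' z) i)" "\<And>z t. g (z + t *\<^sub>R b) = poly (q' z) t"
      by metis
    have "degree (q z + q' z) \<le> max n n'" for z
      using degree_add_le_max[of "q z" "q' z"] *(1,4)[of z] by linarith
    then show ?case using *
      by (intro exI[of _ "\<lambda>z. q z + q' z"] exI[of _ "max n n'"])
        (auto intro!: real_polynomial_function.intros(3))
  next
    case (mult f g)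
    then obtain q n q' n' where *:
      "\<And>z. degree (q z) \<le> n" "\<And>i. real_polynomial_function (\<lambda>z. coeff (q z) i)" "\<And>z t. f (z + t *\<^sub>R b) = poly (q z) t"
      "\<And>z. degree (q' z) \<le> n'" "\<And>i. real_polynomial_function (\<lambda>z. coeff (q' z) i)" "\<And>z t. g (z + t *\<^sub>R b) = poly (q' z) t"
      by metis
    have "degree (q z * q' z) \<le> n + n'" for z
      using degree_mult_le[of "q z" "q' z"] *(1,4)[of z] by linarith
    moreover have "real_polynomial_function (\<lambda>z. coeff (q z * q' z) i)" for i
      unfolding coeff_mult
      by (intro real_polynomial_function_sum real_polynomial_function_mult *) auto
    ultimately show ?case using *
      by (intro exI[of _ "\<lambda>z. q z * q' z"] exI[of _ "n + n'"]) auto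
  qed
  then obtain q n where q: "\<And>z. degree (q z) \<le> n" "\<And>i. real_polynomial_function (\<lambda>z. coeff (q z) i)"
      "\<And>z t. p (z + t *\<^sub>R b) = poly (q z) t" by blast
  define L where "L = map (\<lambda>i z. coeff (q z) i) [0..<Suc n]"
  have "poly_at L z = q z" for z
  proof (rule poly_eqI)
    fix i
    have "coeff (q z) i = 0" if "n < i" using q(1)[of z] that by (intro coeff_eq_0) simp
    then show "coeff (poly_at L z) i = coeff (q z) i"
      by (cases "i \<le> n") (simp_all add: coeff_poly_at L_def del: upt_Suc)
  qed
  moreover have "poly_coeffs L" using q(2) by (auto simp: poly_coeffs_def L_def)
  ultimately show ?thesis using q(3) by (intro exI[of _ L]) simp
qed

text \<open>If the constants of a closed family have equal signs at \<open>z\<close> and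
  \<open>w\<close>, the map \<open>h\<close> of \<open>sign_transfer\<close> turns a witness
  \<open>t\<close> for \<open>z\<close> into the witness \<open>h t\<close> for \<open>w\<close>.
  The parameter keeps its own component along \<open>b\<close>, so no coordinate has to be split
  off.\<close>

lemma semialg_Ex_line:
  fixes b :: "'a::euclidean_space"
  assumes "semialg_pred P" shows "semialg_pred (\<lambda>z. \<exists>t. P (z + t *\<^sub>R b))"
proof -
  obtain S where S': "finite S" "\<forall>p\<in>S. real_polynomial_function p"
      "\<forall>x y. (\<forall>p\<in>S. sgn (p x) = sgn (p y)) \<longrightarrow> P x = P y"
    using assms(1) unfolding semialg_pred_def by (elim exE conjE)
  note S = S'(1) bspec[OF S'(2)] S'(3)[rule_format]
  have "\<And>p. p \<in> S \<Longrightarrow> \<exists>L. poly_coeffs L \<and> (\<forall>z t. p (z + t *\<^sub>R b) = poly (poly_at L z) t)"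
    using S(2) real_polynomial_function_on_line by blast
  then obtain L where L: "\<And>p. p \<in> S \<Longrightarrow> poly_coeffs (L p)"
      "\<And>p z t. p \<in> S \<Longrightarrow> p (z + t *\<^sub>R b) = poly (poly_at (L p) z) t"
    by metis
  obtain T where T: "L ` S \<subseteq> T" "finite T" "\<forall>L\<in>T. poly_coeffs L" "closed_above 1 T"
    using closed_above_1_superset[of "L ` S"] S(1) L(1) by auto
  define C where "C = {c. [c] \<in> T}"
  have "C \<subseteq> hd ` T" by (force simp: C_def image_iff)
  then have finC: "finite C" using T(2) finite_subset by blast
  have polyC: "\<forall>c\<in>C. real_polynomial_function c"
    using T(3) by (force simp: C_def poly_coeffs_def)
  have imp: "\<exists>t. P (w + t *\<^sub>R b)" if P: "P (z + t *\<^sub>R b)" and eq: "\<And>c. c \<in> C \<Longrightarrow> sgn (c z) = sgn (c w)" for z w t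
  proof -
    obtain h :: "real \<Rightarrow> real" where
      h: "\<And>p t. p \<in> T \<Longrightarrow> sgn (poly (poly_at p z) t) = sgn (poly (poly_at p w) (h t))"
      using sign_transfer[OF T(2,4), of z w T] eq by (auto simp: C_def)
    have "\<forall>p\<in>S. sgn (p (z + t *\<^sub>R b)) = sgn (p (w + h t *\<^sub>R b))"
    proof
      fix p assume p: "p \<in> S"
      then have "L p \<in> T" using T(1) by auto
      then show "sgn (p (z + t *\<^sub>R b)) = sgn (p (w + h t *\<^sub>R b))"
        using h[of "L p" t] L(2)[OF p] by simp
    qed
    then have "P (z + t *\<^sub>R b) = P (w + h t *\<^sub>R b)" by (intro S(3)) simp
    then show ?thesis using P by blast
  qed
  show ?thesis
  proof (rule saI[OF finC])
    show "real_polynomial_function c" if "c \<in> C" for c using polyC that by simp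
    show "(\<exists>t. P (z + t *\<^sub>R b)) = (\<exists>t. P (w + t *\<^sub>R b))" if "\<And>c. c \<in> C \<Longrightarrow> sgn (c z) = sgn (c w)" for z w
      using imp[of z _ w] imp[of w _ z] that by auto
  qed
qed

lemma semialg_Ex_span:
  assumes "finite B" "semialg_pred P"
  shows "semialg_pred (\<lambda>z. \<exists>f. P (z + (\<Sum>b\<in>B. f b *\<^sub>R b)))"
  using assms
proof (induction B arbitrary: P rule: finite_induct)
  case empty
  then show ?case by simp
next
  case (insert b B)
  have "(\<exists>f. P (z + (\<Sum>b\<in>insert b B. f b *\<^sub>R b))) \<longleftrightarrow>
    (\<exists>f t. P (z + (\<Sum>b\<in>B. f b *\<^sub>R b) + t *\<^sub>R b))" for z
  proof
    assume "\<exists>f. P (z + (\<Sum>b\<in>insert b B. f b *\<^sub>R b))"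
    then obtain f where "P (z + (\<Sum>b\<in>insert b B. f b *\<^sub>R b))" ..
    then show "\<exists>f t. P (z + (\<Sum>b\<in>B. f b *\<^sub>R b) + t *\<^sub>R b)"
      using insert.hyps by (intro exI[of _ f] exI[of _ "f b"]) (simp add: algebra_simps)
  next
    assume "\<exists>f t. P (z + (\<Sum>b\<in>B. f b *\<^sub>R b) + t *\<^sub>R b)"
    then obtain f t where P: "P (z + (\<Sum>b\<in>B. f b *\<^sub>R b) + t *\<^sub>R b)" by blast
    have "(\<Sum>c\<in>insert b B. (f(b := t)) c *\<^sub>R c) = t *\<^sub>R b + (\<Sum>c\<in>B. f c *\<^sub>R c)"
      using insert.hyps by (auto intro!: sum.cong)
    then show "\<exists>f. P (z + (\<Sum>b\<in>insert b B. f b *\<^sub>R b))"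
      using P by (intro exI[of _ "f(b := t)"]) (simp only: algebra_simps)
  qed
  then show ?case using insert.IH[OF semialg_Ex_line[OF insert.prems, of b]] by simp
qed

text \<open>The bound variable is spread over the directions \<open>(0, b)\<close>, which are
  eliminated one at a time starting from the point \<open>(x, 0)\<close>.\<close>

lemma semialg_Ex:
  fixes P :: "'a::euclidean_space \<Rightarrow> 'b::euclidean_space \<Rightarrow> bool"
  assumes "semialg_pred (\<lambda>z. P (fst z) (snd z))"
  shows "semialg_pred (\<lambda>x. \<exists>y. P x y)"
proof -
  define B where "B = (\<lambda>b. (0::'a, b::'b)) ` Basis"
  define Q where "Q = (\<lambda>z. P (fst z) (snd z))"
  have sum: "(\<Sum>c\<in>B. f c *\<^sub>R c) = (0, \<Sum>b\<in>Basis. f (0, b) *\<^sub>R b)" for f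
  proof -
    have "(\<Sum>c\<in>B. f c *\<^sub>R c) = (\<Sum>b\<in>Basis. f (0, b) *\<^sub>R (0, b))"
      unfolding B_def by (subst sum.reindex) (auto simp: inj_on_def)
    then show ?thesis by (simp add: prod_eq_iff fst_sum snd_sum)
  qed
  have "semialg_pred (\<lambda>z. \<exists>f. Q (z + (\<Sum>b\<in>B. f b *\<^sub>R b)))"
    by (rule semialg_Ex_span) (use assms in \<open>auto simp: B_def Q_def\<close>)
  then have "semialg_pred (\<lambda>x. \<exists>f. Q ((x, 0) + (\<Sum>b\<in>B. f b *\<^sub>R b)))"
    by (rule semialg_compose) (intro polynomial_function_bounded_linear bounded_linear_intros)
  moreover have "(\<exists>f. Q ((x, 0) + (\<Sum>b\<in>B. f b *\<^sub>R b))) \<longleftrightarrow> (\<exists>y. P x y)" for x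
  proof
    assume "\<exists>y. P x y"
    then obtain y where "P x y" ..
    then show "\<exists>f. Q ((x, 0) + (\<Sum>b\<in>B. f b *\<^sub>R b))"
      by (intro exI[of _ "\<lambda>c. y \<bullet> snd c"]) (simp add: sum Q_def euclidean_representation)
  qed (auto simp: sum Q_def)
  ultimately show ?thesis by simp
qed

lemma semialg_All:
  assumes "semialg_pred (\<lambda>z. P (fst z) (snd z))"
  shows "semialg_pred (\<lambda>x. \<forall>y. P x y)"
  using semialg_Not[OF semialg_Ex[of "\<lambda>x y. \<not> P x y"]] semialg_Not[OF assms] by simp

section \<open>Calculus of semi-algebraic functions: substitution, arithmetic and norms\<close>

lemma polynomial_function_fst: "polynomial_function u \<Longrightarrow> polynomial_function (\<lambda>x. fst (u x))"
  using polynomial_function_compose[OF _ polynomial_function_bounded_linear[OF bounded_linear_fst]]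
  by (simp add: o_def)

lemma polynomial_function_snd: "polynomial_function u \<Longrightarrow> polynomial_function (\<lambda>x. snd (u x))"
  using polynomial_function_compose[OF _ polynomial_function_bounded_linear[OF bounded_linear_snd]]
  by (simp add: o_def)

lemma polynomial_function_Pair:
  fixes u :: "'a::euclidean_space \<Rightarrow> 'b::euclidean_space" and v :: "'a \<Rightarrow> 'c::euclidean_space"
  assumes "polynomial_function u" "polynomial_function v"
  shows "polynomial_function (\<lambda>x. (u x, v x))"
proof -
  have "polynomial_function (\<lambda>x. (u x, 0::'c) + (0::'b, v x))"
    by (intro polynomial_function_add
        polynomial_function_compose[OF assms(1) polynomial_function_bounded_linear, unfolded o_def, of "\<lambda>a. (a, 0)"]
        polynomial_function_compose[OF assms(2) polynomial_function_bounded_linear, unfolded o_def, of "\<lambda>a. (0, a)"]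
        bounded_linear_intros)
  then show ?thesis by simp
qed

lemma real_polynomial_function_inner:
  fixes u v :: "'a::euclidean_space \<Rightarrow> 'b::euclidean_space"
  assumes "polynomial_function u" "polynomial_function v"
  shows "real_polynomial_function (\<lambda>x. u x \<bullet> v x)"
proof -
  have "real_polynomial_function (\<lambda>x. \<Sum>b\<in>Basis. (u x \<bullet> b) * (v x \<bullet> b))"
    using assms unfolding polynomial_function_iff_Basis_inner
    by (intro real_polynomial_function_sum real_polynomial_function_mult) auto
  then show ?thesis by (simp only: euclidean_inner[symmetric])
qed

lemmas poly_fun_intros = polynomial_function_fst polynomial_function_snd polynomial_function_Pair
  polynomial_function_id polynomial_function_const polynomial_function_add polynomial_function_diff
  polynomial_function_minus polynomial_function_mult

lemma semialg_fun_poly: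
  fixes u :: "'a::euclidean_space \<Rightarrow> 'b::euclidean_space"
  assumes "polynomial_function u"
  shows "semialg_fun u"
proof -
  have "polynomial_function (\<lambda>z::'a \<times> 'b. u (fst z))"
    using polynomial_function_compose[OF polynomial_function_fst[OF polynomial_function_id] assms] by (simp add: o_def)
  note p = this
  have "real_polynomial_function (\<lambda>z. (snd z - u (fst z)) \<bullet> (snd z - u (fst z)))"
    by (intro real_polynomial_function_inner polynomial_function_diff p
        polynomial_function_snd polynomial_function_id)
  from semialg_eq_0[OF this] show ?thesis by (simp add: semialg_fun_def)
qed

text \<open>A function known only through its graph is substituted at the cost of one quantifier;
  closure under composition, and with it arithmetic, rests on this.\<close>

lemma semialg_subst:
  assumes "semialg_pred P" "semialg_fun u" shows "semialg_pred (\<lambda>x. P (u x))"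
proof -
  have "semialg_pred (\<lambda>x. \<exists>y. y = u x \<and> P y)"
    using assms by (intro semialg_Ex semialg_conj) (auto simp: semialg_fun_def intro!: semialg_compose poly_fun_intros)
  then show ?thesis by simp
qed

lemma semialg_fun_comp_poly:
  fixes u :: "'b::euclidean_space \<Rightarrow> 'c::euclidean_space" and p :: "'a::euclidean_space \<Rightarrow> 'b"
  assumes u: "semialg_fun u" and p: "polynomial_function p"
  shows "semialg_fun (\<lambda>x. u (p x))"
proof -
  have "polynomial_function (\<lambda>z::'a \<times> 'c. p (fst z))"
    using polynomial_function_compose[OF polynomial_function_fst[OF polynomial_function_id] p] by (simp add: o_def)
  then have "polynomial_function (\<lambda>z::'a \<times> 'c. (p (fst z), snd z))"
    by (rule polynomial_function_Pair) (intro poly_fun_intros)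
  from semialg_compose[OF u[unfolded semialg_fun_def] this] show ?thesis by (simp add: semialg_fun_def)
qed

lemma semialg_fun_Pair:
  fixes u :: "'a::euclidean_space \<Rightarrow> 'b::euclidean_space" and v :: "'a \<Rightarrow> 'c::euclidean_space"
  assumes "semialg_fun u" "semialg_fun v" shows "semialg_fun (\<lambda>x. (u x, v x))"
proof -
  have p: "polynomial_function (\<lambda>z::'a \<times> 'b \<times> 'c. (fst z, fst (snd z)))"
    "polynomial_function (\<lambda>z::'a \<times> 'b \<times> 'c. (fst z, snd (snd z)))"
    by (intro poly_fun_intros)+
  show ?thesis
    using semialg_conj[OF semialg_compose[OF assms(1)[unfolded semialg_fun_def] p(1)]
        semialg_compose[OF assms(2)[unfolded semialg_fun_def] p(2)]]
    by (simp add: semialg_fun_def prod_eq_iff)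
qed

lemma semialg_fun_compose:
  assumes "semialg_fun g" "semialg_fun u" shows "semialg_fun (\<lambda>x. g (u x))"
proof -
  have "semialg_fun (\<lambda>z. (u (fst z), snd z))"
    by (intro semialg_fun_Pair semialg_fun_comp_poly[OF assms(2)] semialg_fun_poly poly_fun_intros)
  from semialg_subst[OF assms(1)[unfolded semialg_fun_def] this] show ?thesis by (simp add: semialg_fun_def)
qed

lemma semialg_fun_binop:
  assumes "semialg_fun (\<lambda>p. F (fst p) (snd p))" "semialg_fun u" "semialg_fun v"
  shows "semialg_fun (\<lambda>x. F (u x) (v x))"
  using semialg_fun_compose[OF assms(1) semialg_fun_Pair[OF assms(2,3)]] by simp

lemma semialg_fun_ident: "semialg_fun (\<lambda>x. x)"
  and semialg_fun_const: "semialg_fun (\<lambda>x. c)"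
  by (intro semialg_fun_poly poly_fun_intros)+

lemma semialg_fun_fst: "semialg_fun u \<Longrightarrow> semialg_fun (\<lambda>x. fst (u x))"
  by (rule semialg_fun_compose[OF semialg_fun_poly[OF polynomial_function_fst[OF polynomial_function_id]]])

lemma semialg_fun_snd: "semialg_fun u \<Longrightarrow> semialg_fun (\<lambda>x. snd (u x))"
  by (rule semialg_fun_compose[OF semialg_fun_poly[OF polynomial_function_snd[OF polynomial_function_id]]])

lemma semialg_fun_minus: "semialg_fun u \<Longrightarrow> semialg_fun (\<lambda>x. - u x)"
  by (rule semialg_fun_compose[OF semialg_fun_poly[OF polynomial_function_minus[OF polynomial_function_id]]])

lemma semialg_fun_add:
  fixes u v :: "'a::euclidean_space \<Rightarrow> 'b::euclidean_space"
  assumes "semialg_fun u" "semialg_fun v" shows "semialg_fun (\<lambda>x. u x + v x)"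
proof -
  have "polynomial_function (\<lambda>p::'b \<times> 'b. fst p + snd p)" by (intro poly_fun_intros)
  from semialg_fun_binop[OF semialg_fun_poly[OF this] assms] show ?thesis .
qed

lemma semialg_fun_diff:
  fixes u v :: "'a::euclidean_space \<Rightarrow> 'b::euclidean_space"
  assumes "semialg_fun u" "semialg_fun v" shows "semialg_fun (\<lambda>x. u x - v x)"
proof -
  have "polynomial_function (\<lambda>p::'b \<times> 'b. fst p - snd p)" by (intro poly_fun_intros)
  from semialg_fun_binop[OF semialg_fun_poly[OF this] assms] show ?thesis .
qed

lemma semialg_fun_inner:
  fixes u v :: "'a::euclidean_space \<Rightarrow> 'b::euclidean_space"
  assumes "semialg_fun u" "semialg_fun v" shows "semialg_fun (\<lambda>x. u x \<bullet> v x)"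
proof -
  have "real_polynomial_function (\<lambda>p::'b \<times> 'b. fst p \<bullet> snd p)"
    by (intro real_polynomial_function_inner poly_fun_intros)
  from semialg_fun_binop[OF semialg_fun_poly[OF this[unfolded real_polynomial_function_eq]] assms] show ?thesis .
qed

lemma semialg_fun_mult:
  fixes u v :: "'a::euclidean_space \<Rightarrow> real"
  shows "semialg_fun u \<Longrightarrow> semialg_fun v \<Longrightarrow> semialg_fun (\<lambda>x. u x * v x)"
  using semialg_fun_inner[of u v] by simp

lemma semialg_less:
  assumes "semialg_fun u" "semialg_fun v" shows "semialg_pred (\<lambda>x. u x < (v x :: real))"
proof -
  have "polynomial_function (\<lambda>z::real \<times> real. snd z - fst z)" by (intro poly_fun_intros)
  then have "semialg_pred (\<lambda>z::real \<times> real. fst z < snd z)"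
    using semialg_pos[of "\<lambda>z::real \<times> real. snd z - fst z"] by (simp add: real_polynomial_function_eq)
  from semialg_subst[OF this semialg_fun_Pair[OF assms]] show ?thesis by simp
qed

lemma semialg_le: "semialg_fun u \<Longrightarrow> semialg_fun v \<Longrightarrow> semialg_pred (\<lambda>x. u x \<le> (v x :: real))"
  using semialg_Not[OF semialg_less[of v u]] by (simp add: not_less)

lemma semialg_eq:
  assumes "semialg_fun u" "semialg_fun v" shows "semialg_pred (\<lambda>x. u x = v x)"
  using semialg_subst[OF semialg_fun_ident[unfolded semialg_fun_def] semialg_fun_Pair[OF assms(2,1)]] by simp

lemma semialg_fun_norm:
  assumes "semialg_fun u" shows "semialg_fun (\<lambda>x. norm (u x))"
proof -
  have "semialg_pred (\<lambda>z::'b \<times> real. 0 \<le> snd z \<and> snd z * snd z = fst z \<bullet> fst z)"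
    by (intro semialg_conj semialg_le semialg_eq semialg_fun_mult semialg_fun_inner semialg_fun_const semialg_fun_fst semialg_fun_snd semialg_fun_ident)
  moreover have "(0 \<le> r \<and> r * r = a \<bullet> a) \<longleftrightarrow> r = norm a" for r and a :: 'b
    by (metis norm_ge_zero norm_eq_sqrt_inner power2_eq_square power2_norm_eq_inner real_sqrt_unique)
  ultimately have "semialg_fun (\<lambda>a::'b. norm a)" by (simp add: semialg_fun_def)
  then show ?thesis using assms by (rule semialg_fun_compose)
qed

lemmas semialg_intros = semialg_conj semialg_disj semialg_imp semialg_Not semialg_Ex semialg_All semialg_less semialg_le semialg_eq semialg_const
  semialg_fun_ident semialg_fun_fst semialg_fun_snd semialg_fun_Pair semialg_fun_add semialg_fun_diff semialg_fun_minus
  semialg_fun_mult semialg_fun_inner semialg_fun_norm semialg_fun_const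

text \<open>The bridge from the form in which the hypotheses are given: membership is a Boolean
  combination of the signs of finitely many \<open>p i j\<close> and \<open>q i j\<close>.\<close>

lemma semialg_mem_semi_algebraic:
  assumes "semi_algebraic S" shows "semialg_pred (\<lambda>x. x \<in> S)"
proof -
  obtain s t :: nat and p q :: "nat \<Rightarrow> nat \<Rightarrow> 'a \<Rightarrow> real" where
    pq: "\<forall>i j. real_polynomial_function (p i j) \<and> real_polynomial_function (q i j)" and
    S: "S = (\<Union>j\<in>{1..s}. \<Inter>i\<in>{1..t}. {x. p i j x = 0 \<and> q i j x < 0})"
    using assms unfolding semi_algebraic_def by (elim exE conjE)
  define T where "T = (\<lambda>(i, j). p i j) ` ({1..t} \<times> {1..s}) \<union> (\<lambda>(i, j). q i j) ` ({1..t} \<times> {1..s})"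
  have "(x \<in> S) = (y \<in> S)" if xy: "\<And>r. r \<in> T \<Longrightarrow> sgn (r x) = sgn (r y)" for x y
  proof -
    have "(p i j x = 0 \<and> q i j x < 0) = (p i j y = 0 \<and> q i j y < 0)" if "i \<in> {1..t}" "j \<in> {1..s}" for i j
    proof -
      have "p i j \<in> T" "q i j \<in> T" using that by (force simp: T_def)+
      then have "sgn (p i j x) = sgn (p i j y)" "sgn (q i j x) = sgn (q i j y)" using xy by auto
      then show ?thesis by (auto simp: sgn_if split: if_splits)
    qed
    then show ?thesis unfolding S by auto
  qed
  moreover have "real_polynomial_function r" if "r \<in> T" for r
    using that unfolding T_def by (elim UnE imageE) (simp_all add: pq split_beta)
  moreover have "finite T" by (simp add: T_def)
  ultimately show ?thesis by (intro saI[of T]) blast+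
qed

section \<open>Germs of semi-algebraic functions of one variable\<close>

lemma real_polynomial_function_sgn_at_right:
  fixes p :: "real \<Rightarrow> real"
  assumes "real_polynomial_function p"
  shows "\<exists>s. \<forall>\<^sub>F x in at_right a. sgn (p x) = s"
proof -
  obtain c n where cn: "p = (\<lambda>x. \<Sum>i\<le>n. c i * x ^ i)"
    using assms unfolding real_polynomial_function_iff_sum by blast
  define q where "q = (\<Sum>i\<le>n. monom (c i) i)"
  have q: "p x = poly q x" for x by (simp add: cn q_def poly_sum poly_monom)
  show ?thesis
  proof (cases "q = 0")
    case True
    then show ?thesis using q by (intro exI[of _ 0]) simp
  next
    case False
    have "\<forall>\<^sub>F x in at_right a. \<forall>r\<in>{r. poly q r = 0}. x \<noteq> r"
      by (rule eventually_ball_finite[OF poly_roots_finite[OF False]]) (simp add: eventually_neq_at_within)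
    then obtain b where b: "a < b" "\<And>x. a < x \<Longrightarrow> x < b \<Longrightarrow> poly q x \<noteq> 0"
      unfolding eventually_at_right_field by blast
    have "sgn (p x) = sgn (p ((a + b) / 2))" if "a < x" "x < b" for x
      unfolding q by (rule poly_sgn_const) (use b that in \<open>auto simp: min_def max_def split: if_splits\<close>)
    then show ?thesis unfolding eventually_at_right_field using b(1) by blast
  qed
qed

text \<open>One-variable tameness (o-minimality): finitely many polynomials have constant signs
  immediately to the right of \<open>a\<close>, so a predicate determined by these signs cannot
  oscillate there.\<close>

lemma semialg_eventually_at_right:
  fixes P :: "real \<Rightarrow> bool"
  assumes "semialg_pred P"
  shows "(\<forall>\<^sub>F x in at_right a. P x) \<or> (\<forall>\<^sub>F x in at_right a. \<not> P x)"
proof -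
  obtain S where S: "finite S" "\<forall>p\<in>S. real_polynomial_function p"
      "\<forall>x y. (\<forall>p\<in>S. sgn (p x) = sgn (p y)) \<longrightarrow> P x = P y"
    using assms unfolding semialg_pred_def by (elim exE conjE)
  have "\<forall>p\<in>S. \<exists>s. \<forall>\<^sub>F x in at_right a. sgn (p x) = s"
    using S(2) real_polynomial_function_sgn_at_right by blast
  then obtain s where "\<forall>p\<in>S. \<forall>\<^sub>F x in at_right a. sgn (p x) = s p" by metis
  then have ev: "\<forall>\<^sub>F x in at_right a. \<forall>p\<in>S. sgn (p x) = s p"
    by (rule eventually_ball_finite[OF S(1)])
  then obtain x0 where x0: "\<forall>p\<in>S. sgn (p x0) = s p"
    using eventually_happens[OF ev] by auto
  have "\<forall>\<^sub>F x in at_right a. P x = P x0"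
    using ev by eventually_elim (use S(3) x0 in auto)
  then show ?thesis by (cases "P x0") auto
qed

lemma semialg_eventually_at_left:
  fixes P :: "real \<Rightarrow> bool"
  assumes "semialg_pred P"
  shows "(\<forall>\<^sub>F x in at_left a. P x) \<or> (\<forall>\<^sub>F x in at_left a. \<not> P x)"
proof -
  have "semialg_pred (\<lambda>x. P (- x))" using semialg_subst[OF assms semialg_fun_minus[OF semialg_fun_ident]] .
  from semialg_eventually_at_right[OF this, of "- a"] show ?thesis
    by (simp add: at_left_minus[of a] eventually_filtermap)
qed

text \<open>A point is coded by a gap size \<open>1 / Suc n\<close>, a rational close to its value,
  and the cell of width \<open>1 / Suc n\<close> containing it. Two points with one code would be
  close enough for the gap to apply, yet their values would both be within half a gap of one
  rational.\<close>

lemma countable_right_gap: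
  fixes u :: "real \<Rightarrow> real"
  shows "countable {t. \<exists>e>0. \<forall>\<^sub>F s in at_right t. e \<le> \<bar>u s - u t\<bar>}"
proof -
  define B where "B = {t. \<exists>e>0. \<forall>\<^sub>F s in at_right t. e \<le> \<bar>u s - u t\<bar>}"
  define G where "G t n q \<longleftrightarrow> (\<forall>s. t < s \<longrightarrow> s < t + 1 / Suc n \<longrightarrow> 1 / Suc n \<le> \<bar>u s - u t\<bar>) \<and>
      \<bar>u t - of_rat q\<bar> < 1 / (2 * Suc n)" for t n q
  have "\<exists>n q. G t n q" if tB: "t \<in> B" for t
  proof -
    obtain e where e: "e > 0" "\<forall>\<^sub>F s in at_right t. e \<le> \<bar>u s - u t\<bar>" using tB unfolding B_def by blast
    then obtain b where b: "b > t" "\<And>s. t < s \<Longrightarrow> s < b \<Longrightarrow> e \<le> \<bar>u s - u t\<bar>"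
      unfolding eventually_at_right_field by blast
    obtain n where n: "1 / real (Suc n) < min e (b - t)"
      using reals_Archimedean[of "min e (b - t)"] e b by (auto simp: inverse_eq_divide)
    have "u t < u t + 1 / (2 * real (Suc n))" by simp
    then obtain q where q: "u t < of_rat q" "of_rat q < u t + 1 / (2 * real (Suc n))"
      using of_rat_dense by blast
    show ?thesis unfolding G_def
    proof (intro exI conjI allI impI)
      show "1 / Suc n \<le> \<bar>u s - u t\<bar>" if "t < s" "s < t + 1 / Suc n" for s
        using b(2)[of s] n that by linarith
      show "\<bar>u t - of_rat q\<bar> < 1 / (2 * Suc n)" using q by linarith
    qed
  qed
  then obtain n q where G: "\<And>t. t \<in> B \<Longrightarrow> G t (n t) (q t)" by metis
  have
    n: "t \<in> B \<Longrightarrow> t < s \<Longrightarrow> s < t + 1 / Suc (n t) \<Longrightarrow> 1 / Suc (n t) \<le> \<bar>u s - u t\<bar>" and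
    q: "t \<in> B \<Longrightarrow> \<bar>u t - of_rat (q t)\<bar> < 1 / (2 * Suc (n t))" for t s
    using G unfolding G_def by blast+
  define h where "h = (\<lambda>t. (n t, q t, \<lfloor>t * Suc (n t)\<rfloor>))"
  have no: False if tB: "t \<in> B" "t' \<in> B" and lt: "t < t'" and eq: "h t = h t'" for t t'
  proof -
    have "n t = n t' \<and> q t = q t' \<and> \<lfloor>t * Suc (n t)\<rfloor> = \<lfloor>t' * Suc (n t')\<rfloor>"
      using eq unfolding h_def prod.inject .
    then have e: "n t' = n t" "q t' = q t" "\<lfloor>t * Suc (n t)\<rfloor> = \<lfloor>t' * Suc (n t')\<rfloor>"
      by metis+
    define N where "N = real (Suc (n t))"
    have N: "N > 0" "real (Suc (n t')) = N" using e by (simp_all add: N_def)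
    have fl: "\<lfloor>t * N\<rfloor> = \<lfloor>t' * N\<rfloor>" using e(1,3) by (simp only: N_def)
    have "t' * N < t * N + 1" using fl by linarith
    then have "(t' - t) * N < 1" by (simp add: algebra_simps)
    then have "t' < t + 1 / N" using N by (simp add: field_simps)
    then have "1 / N \<le> \<bar>u t' - u t\<bar>" using n[OF tB(1) lt] by (simp add: N_def)
    moreover have "\<bar>u t - of_rat (q t)\<bar> < 1 / (2 * N)" using q[OF tB(1)] by (simp add: N_def)
    moreover have "\<bar>u t' - of_rat (q t)\<bar> < 1 / (2 * N)" using q[OF tB(2)] e(1,2) by (simp add: N_def)
    moreover have "1 / N = 1 / (2 * N) + 1 / (2 * N)" by (simp add: field_simps)
    ultimately show False by linarith
  qed
  have "inj_on h B"
    by (rule inj_onI, rule ccontr) (metis no linorder_neqE)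
  then have "countable B" by (rule countable_image_inj_on[rotated]) simp
  then show ?thesis by (simp only: B_def)
qed

lemma countable_left_gap:
  fixes u :: "real \<Rightarrow> real"
  shows "countable {t. \<exists>e>0. \<forall>\<^sub>F s in at_left t. e \<le> \<bar>u s - u t\<bar>}"
proof -
  have "{t. \<exists>e>0. \<forall>\<^sub>F s in at_left t. e \<le> \<bar>u s - u t\<bar>} \<subseteq>
    uminus ` {t. \<exists>e>0. \<forall>\<^sub>F s in at_right t. e \<le> \<bar>u (- s) - u (- t)\<bar>}"
  proof
    fix t assume "t \<in> {t. \<exists>e>0. \<forall>\<^sub>F s in at_left t. e \<le> \<bar>u s - u t\<bar>}"
    then have "- t \<in> {t. \<exists>e>0. \<forall>\<^sub>F s in at_right t. e \<le> \<bar>u (- s) - u (- t)\<bar>}"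
      by (simp add: at_left_minus[of t] eventually_filtermap)
    then show "t \<in> uminus ` {t. \<exists>e>0. \<forall>\<^sub>F s in at_right t. e \<le> \<bar>u (- s) - u (- t)\<bar>}"
      by (metis (no_types, lifting) image_eqI minus_minus)
  qed
  moreover have "countable {t. \<exists>e>0. \<forall>\<^sub>F s in at_right t. e \<le> \<bar>u (- s) - u (- t)\<bar>}"
    by (rule countable_right_gap)
  ultimately show ?thesis by (metis (no_types, lifting) countable_image countable_subset)
qed

text \<open>Every real function returns close to its value from both sides outside a countable set; for a
  semi-algebraic function returning frequently means staying close eventually.\<close>

lemma semialg_fun_eventually_isCont:
  fixes u :: "real \<Rightarrow> real"
  assumes u: "semialg_fun u"
  shows "\<forall>\<^sub>F t in at_right a. isCont u t"
proof (rule ccontr)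
  note uc = semialg_fun_compose[OF u]
  \<comment> \<open>Written out with quantifiers and norms, continuity at \<open>t\<close> is itself
    a semi-algebraic condition on \<open>t\<close>, so the dichotomy applies to it.\<close>
  have "isCont u t \<longleftrightarrow> (\<forall>e. 0 < e \<longrightarrow> (\<exists>d. 0 < d \<and> (\<forall>s. norm (s - t) < d \<longrightarrow> norm (u s - u t) < e)))" for t
    unfolding continuous_at_eps_delta dist_norm by blast
  then have saC: "semialg_pred (isCont u)"
    using semialg_All by (simp only:) (intro semialg_intros uc)
  assume "\<not> ?thesis"
  then have "\<forall>\<^sub>F t in at_right a. \<not> isCont u t" using semialg_eventually_at_right[OF saC, of a] by blast
  then obtain b where b: "a < b" "\<And>t. a < t \<Longrightarrow> t < b \<Longrightarrow> \<not> isCont u t"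
    unfolding eventually_at_right_field by blast
  define B where "B = {t. \<exists>e>0. \<forall>\<^sub>F s in at_right t. e \<le> \<bar>u s - u t\<bar>} \<union> {t. \<exists>e>0. \<forall>\<^sub>F s in at_left t. e \<le> \<bar>u s - u t\<bar>}"
  have "countable B" unfolding B_def using countable_right_gap[of u] countable_left_gap[of u] by simp
  moreover have "uncountable {a<..<b}" using b(1) by (simp add: uncountable_open_interval)
  ultimately have "\<not> {a<..<b} \<subseteq> B" using countable_subset by blast
  then obtain t where "t \<in> {a<..<b}" "t \<notin> B" by blast
  then have t: "a < t" "t < b" "t \<notin> B" by simp_all
  have "isCont u t"
    unfolding isCont_def tendsto_iff dist_real_def
  proof (intro allI impI)
    fix e :: real assume e: "0 < e"
    have s: "semialg_pred (\<lambda>s. e \<le> \<bar>u s - u t\<bar>)"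
      unfolding real_norm_def[symmetric] by (intro semialg_intros uc)
    have "\<not> (\<forall>\<^sub>F s in at_right t. e \<le> \<bar>u s - u t\<bar>)" "\<not> (\<forall>\<^sub>F s in at_left t. e \<le> \<bar>u s - u t\<bar>)"
      using t(3) e unfolding B_def by blast+
    then have "\<forall>\<^sub>F s in at_right t. \<not> e \<le> \<bar>u s - u t\<bar>" "\<forall>\<^sub>F s in at_left t. \<not> e \<le> \<bar>u s - u t\<bar>"
      using semialg_eventually_at_right[OF s, of t] semialg_eventually_at_left[OF s, of t] by blast+
    then show "\<forall>\<^sub>F s in at t. \<bar>u s - u t\<bar> < e" by (simp add: eventually_at_split not_le)
  qed
  then show False using b(2) t by blast
qed

text \<open>Monotonicity without derivatives: the infimum of the points where \<open>\<psi>\<close>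
  is at most \<open>\<psi> b\<close> belongs to this set by continuity, and the local condition
  would move it further left unless it equals \<open>a\<close>.\<close>

lemma le_of_eventually_at_left_le:
  fixes \<psi> :: "real \<Rightarrow> real"
  assumes "a \<le> b" "continuous_on {a..b} \<psi>"
    and loc: "\<And>t. a < t \<Longrightarrow> t \<le> b \<Longrightarrow> \<forall>\<^sub>F s in at_left t. \<psi> s \<le> \<psi> t"
  shows "\<psi> a \<le> \<psi> b"
proof (rule ccontr)
  assume lt: "\<not> \<psi> a \<le> \<psi> b"
  define S where "S = {t\<in>{a..b}. \<psi> t \<le> \<psi> b}"
  have "S = {a..b} \<inter> \<psi> -` {..\<psi> b}" by (auto simp: S_def)
  then have "closed S" by (simp add: continuous_closed_preimage[OF assms(2)])
  moreover have "b \<in> S" "bdd_below S" using assms(1) by (auto simp: S_def)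
  ultimately have m: "Inf S \<in> S" by (intro closed_contains_Inf) auto
  define m where "m = Inf S"
  have mS: "m \<in> S" using m by (simp add: m_def)
  then have "a < m" using lt by (auto simp: S_def less_le)
  moreover have "m \<le> b" using mS by (auto simp: S_def)
  ultimately obtain c where c: "c < m" "\<And>s. c < s \<Longrightarrow> s < m \<Longrightarrow> \<psi> s \<le> \<psi> m"
    using loc[of m] unfolding eventually_at_left_field by blast
  obtain s where s: "max a c < s" "s < m" using dense[of "max a c" m] \<open>a < m\<close> c(1) by auto
  then have "s \<in> S" using c(2)[of s] mS by (auto simp: S_def)
  then have "m \<le> s" unfolding m_def by (rule cInf_lower) (rule \<open>bdd_below S\<close>)
  then show False using s by simp
qed

text \<open>Close to 0 the comparison of \<open>u t\<close> with the values just left of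
  \<open>t\<close> goes the same way for all \<open>t\<close>; \<open>\<sigma>\<close> records which
  way. Eventual continuity turns this local comparison into monotonicity on an interval.\<close>

lemma semialg_fun_eventually_mono:
  fixes u :: "real \<Rightarrow> real"
  assumes u: "semialg_fun u"
  shows "\<exists>\<sigma>. \<bar>\<sigma>\<bar> = 1 \<and> (\<exists>d>0. (\<forall>t. 0 < t \<longrightarrow> t < d \<longrightarrow> isCont u t) \<and>
    (\<forall>s t. 0 < s \<longrightarrow> s \<le> t \<longrightarrow> t < d \<longrightarrow> \<sigma> * u s \<le> \<sigma> * u t))"
proof -
  note uc = semialg_fun_compose[OF u]
  define R where "R t \<longleftrightarrow> (\<exists>b. b < t \<and> (\<forall>s. b < s \<longrightarrow> s < t \<longrightarrow> u s \<le> u t))" for t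
  have "semialg_pred R" unfolding R_def[abs_def] by (intro semialg_intros uc)
  have R: "R t \<longleftrightarrow> (\<forall>\<^sub>F s in at_left t. u s \<le> u t)" for t
    unfolding R_def eventually_at_left_field by blast
  have "\<exists>\<sigma>. \<bar>\<sigma>\<bar> = 1 \<and> (\<forall>\<^sub>F t in at_right 0. \<forall>\<^sub>F s in at_left t. \<sigma> * u s \<le> \<sigma> * u t)"
    using semialg_eventually_at_right[OF \<open>semialg_pred R\<close>, of 0]
  proof
    assume "\<forall>\<^sub>F t in at_right 0. R t"
    then show ?thesis by (intro exI[of _ 1]) (simp add: R)
  next
    assume ev: "\<forall>\<^sub>F t in at_right 0. \<not> R t"
    have "\<forall>\<^sub>F s in at_left t. (-1) * u s \<le> (-1) * u t" if "\<not> R t" for t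
    proof -
      have "semialg_pred (\<lambda>s. u s \<le> u t)" by (intro semialg_intros uc)
      then have "\<forall>\<^sub>F s in at_left t. \<not> u s \<le> u t"
        using semialg_eventually_at_left[of "\<lambda>s. u s \<le> u t" t] that R by blast
      then show ?thesis by eventually_elim simp
    qed
    then show ?thesis using ev by (intro exI[of _ "-1"]) (auto elim: eventually_mono)
  qed
  then obtain \<sigma> where \<sigma>: "\<bar>\<sigma>\<bar> = 1" "\<forall>\<^sub>F t in at_right 0. \<forall>\<^sub>F s in at_left t. \<sigma> * u s \<le> \<sigma> * u t"
    by blast
  then have "\<forall>\<^sub>F t in at_right 0. isCont u t \<and> (\<forall>\<^sub>F s in at_left t. \<sigma> * u s \<le> \<sigma> * u t)"
    using semialg_fun_eventually_isCont[OF u, of 0] by (simp add: eventually_conj)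
  then obtain d where d: "d > 0"
    "\<And>t. 0 < t \<Longrightarrow> t < d \<Longrightarrow> isCont u t \<and> (\<forall>\<^sub>F s in at_left t. \<sigma> * u s \<le> \<sigma> * u t)"
    unfolding eventually_at_right_field by blast
  have "\<sigma> * u s \<le> \<sigma> * u t" if "0 < s" "s \<le> t" "t < d" for s t
    by (rule le_of_eventually_at_left_le[OF that(2), of "\<lambda>t. \<sigma> * u t"])
      (use d(2) that in \<open>auto intro!: continuous_intros continuous_at_imp_continuous_on\<close>)
  then show ?thesis using \<sigma>(1) d by blast
qed

section \<open>Descent along a semi-algebraic function\<close>

lemma semialg_rel:
  "semialg_pred (\<lambda>z. G (fst z) (snd z)) \<Longrightarrow> semialg_fun u \<Longrightarrow> semialg_fun v \<Longrightarrow> semialg_pred (\<lambda>x. G (u x) (v x))"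
  using semialg_subst[OF _ semialg_fun_Pair, of "\<lambda>z. G (fst z) (snd z)" u v] by simp

text \<open>Coordinates are minimised one after the other; compactness of the slices makes each
  minimum attained and passes to the set of minimisers. With \<open>B = Basis\<close> at most one
  point per slice survives, which gives definable choice.\<close>

lemma semialg_lexicographic_refinement:
  fixes G :: "'a::euclidean_space \<Rightarrow> 'b::euclidean_space \<Rightarrow> bool"
  assumes "finite B" "semialg_pred (\<lambda>z. G (fst z) (snd z))" "\<And>t. compact {y. G t y}"
  shows "\<exists>H. semialg_pred (\<lambda>z. H (fst z) (snd z)) \<and> (\<forall>t. compact {y. H t y}) \<and>
    (\<forall>t y. H t y \<longrightarrow> G t y) \<and> (\<forall>t. (\<exists>y. G t y) \<longrightarrow> (\<exists>y. H t y)) \<and>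
    (\<forall>t y y' b. H t y \<longrightarrow> H t y' \<longrightarrow> b \<in> B \<longrightarrow> y \<bullet> b = y' \<bullet> b)"
  using assms(1)
proof (induction B rule: finite_induct)
  case empty
  then show ?case using assms(2,3) by (intro exI[of _ G]) auto
next
  case (insert b B)
  obtain H where *: "semialg_pred (\<lambda>z. H (fst z) (snd z)) \<and> (\<forall>t. compact {y. H t y}) \<and>
    (\<forall>t y. H t y \<longrightarrow> G t y) \<and> (\<forall>t. (\<exists>y. G t y) \<longrightarrow> (\<exists>y. H t y)) \<and>
    (\<forall>t y y' b. H t y \<longrightarrow> H t y' \<longrightarrow> b \<in> B \<longrightarrow> y \<bullet> b = y' \<bullet> b)"
    using insert.IH ..
  then have H: "semialg_pred (\<lambda>z. H (fst z) (snd z))" "\<And>t. compact {y. H t y}"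
    "\<And>t y. H t y \<Longrightarrow> G t y" "\<And>t. (\<exists>y. G t y) \<Longrightarrow> (\<exists>y. H t y)"
    "\<And>t y y' b. H t y \<Longrightarrow> H t y' \<Longrightarrow> b \<in> B \<Longrightarrow> y \<bullet> b = y' \<bullet> b"
    by blast+
  define H' where "H' t y \<longleftrightarrow> H t y \<and> (\<forall>y'. H t y' \<longrightarrow> y \<bullet> b \<le> y' \<bullet> b)" for t y
  have "semialg_pred (\<lambda>z. H' (fst z) (snd z))"
    unfolding H'_def by (intro semialg_intros semialg_rel[OF H(1)])
  moreover have "compact {y. H' t y}" for t
  proof -
    have "{y. H' t y} = {y. H t y} \<inter> (\<Inter>y'\<in>{y'. H t y'}. {y. y \<bullet> b \<le> y' \<bullet> b})"
      by (auto simp: H'_def)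
    moreover have "closed (\<Inter>y'\<in>{y'. H t y'}. {y. y \<bullet> b \<le> y' \<bullet> b})"
      by (intro closed_INT ballI closed_Collect_le continuous_intros)
    ultimately show ?thesis using H(2) by (simp add: compact_Int_closed)
  qed
  moreover have "\<exists>y. H' t y" if "\<exists>y. G t y" for t
  proof -
    have ne: "{y. H t y} \<noteq> {}" using H(4) that by auto
    have "continuous_on {y. H t y} (\<lambda>y. y \<bullet> b)" by (intro continuous_intros)
    from continuous_attains_inf[OF H(2) ne this] show ?thesis by (auto simp: H'_def)
  qed
  moreover have "y \<bullet> c = y' \<bullet> c" if "H' t y" "H' t y'" "c \<in> insert b B" for t y y' c
  proof (cases "c = b")
    case True
    have "y \<bullet> b \<le> y' \<bullet> b" "y' \<bullet> b \<le> y \<bullet> b" using that(1,2) by (auto simp: H'_def)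
    then show ?thesis using True by simp
  next
    case False
    then show ?thesis using that H(5) by (auto simp: H'_def)
  qed
  moreover have "G t y" if "H' t y" for t y using that H(3) by (simp add: H'_def)
  ultimately show ?case by (intro exI[of _ H']) blast
qed

lemma semialg_selection:
  fixes G :: "'a::euclidean_space \<Rightarrow> 'b::euclidean_space \<Rightarrow> bool"
  assumes "semialg_pred (\<lambda>z. G (fst z) (snd z))" "\<And>t. compact {y. G t y}"
  shows "\<exists>\<gamma>. semialg_fun \<gamma> \<and> (\<forall>t. (\<exists>y. G t y) \<longrightarrow> G t (\<gamma> t))"
proof -
  obtain H where *: "semialg_pred (\<lambda>z. H (fst z) (snd z)) \<and> (\<forall>t. compact {y. H t y}) \<and>
    (\<forall>t y. H t y \<longrightarrow> G t y) \<and> (\<forall>t. (\<exists>y. G t y) \<longrightarrow> (\<exists>y. H t y)) \<and>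
    (\<forall>t y y' b. H t y \<longrightarrow> H t y' \<longrightarrow> b \<in> (Basis :: 'b set) \<longrightarrow> y \<bullet> b = y' \<bullet> b)"
    using semialg_lexicographic_refinement[OF finite_Basis assms] ..
  then have H: "semialg_pred (\<lambda>z. H (fst z) (snd z))" "\<And>t y. H t y \<Longrightarrow> G t y"
    "\<And>t. (\<exists>y. G t y) \<Longrightarrow> (\<exists>y. H t y)"
    "\<And>t y y' b. H t y \<Longrightarrow> H t y' \<Longrightarrow> b \<in> (Basis :: 'b set) \<Longrightarrow> y \<bullet> b = y' \<bullet> b"
    by blast+
  have uniq: "y = y'" if "H t y" "H t y'" for t y y'
    by (rule euclidean_eqI) (rule H(4)[OF that])
  \<comment> \<open>The value 0 on empty slices makes \<open>\<gamma>\<close> total and keeps its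
    graph semi-algebraic.\<close>
  define \<gamma> where "\<gamma> t = (if \<exists>y. H t y then THE y. H t y else 0)" for t
  have \<gamma>: "H t (\<gamma> t)" if "H t y" for t y
  proof -
    have "(THE y. H t y) = y" using that uniq by (intro the_equality) auto
    then show ?thesis using that by (auto simp: \<gamma>_def)
  qed
  have "(snd z = \<gamma> (fst z)) \<longleftrightarrow> H (fst z) (snd z) \<or> \<not> (\<exists>y. H (fst z) y) \<and> snd z = 0" for z
  proof (cases "\<exists>y. H (fst z) y")
    case True
    then show ?thesis using \<gamma> uniq by metis
  next
    case False
    then show ?thesis by (auto simp: \<gamma>_def)
  qed
  moreover have "semialg_pred (\<lambda>z. H (fst z) (snd z) \<or> \<not> (\<exists>y. H (fst z) y) \<and> snd z = 0)"
    by (intro semialg_intros semialg_rel[OF H(1)])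
  ultimately have "semialg_fun \<gamma>" by (simp add: semialg_fun_def)
  then show ?thesis using \<gamma> H(2,3) by metis
qed

text \<open>Replaces the distance of \<open>0\<close> to the subdifferential of \<open>F\<close>; as it needs no derivatives, it is
  visibly semi-algebraic.\<close>

definition steepness :: "real \<Rightarrow> 'a::euclidean_space set \<Rightarrow> ('a \<Rightarrow> real) \<Rightarrow> 'a \<Rightarrow> real \<Rightarrow> bool" where
  "steepness C K F x \<sigma> \<longleftrightarrow> x \<in> K \<and> 0 \<le> \<sigma> \<and>
    (\<forall>y. y \<in> K \<longrightarrow> F x - F y \<le> \<sigma> * norm (y - x) + C * (norm (y - x) * norm (y - x)))"

lemma norm_le_variation:
  fixes v :: "'a::euclidean_space"
  assumes "\<And>b. b \<in> Basis \<Longrightarrow> \<bar>v \<bullet> b\<bar> = w b"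
  shows "norm v \<le> (\<Sum>b\<in>Basis. w b)"
  using norm_le_l1[of v] assms by simp

text \<open>The selected curve \<open>\<gamma>\<close> of points of minimal steepness on each level has monotone components,
  and \<open>\<phi>\<close> is the total variation of these components.\<close>

lemma kurdyka_lojasiewicz:
  fixes K :: "'a::euclidean_space set" and F :: "'a \<Rightarrow> real"
  assumes K: "compact K" "semialg_pred (\<lambda>x. x \<in> K)" and F: "semialg_fun F" "continuous_on K F"
  shows "\<exists>\<phi> d B. 0 < d \<and> (\<forall>t. 0 < t \<longrightarrow> t < d \<longrightarrow> B \<le> \<phi> t) \<and>
    (\<forall>s t. 0 < s \<longrightarrow> s \<le> t \<longrightarrow> t < d \<longrightarrow> \<phi> s \<le> \<phi> t) \<and>
    (\<forall>x \<sigma> s t. steepness C K F x \<sigma> \<longrightarrow> F x = c + t \<longrightarrow> 0 < s \<longrightarrow> s \<le> t \<longrightarrow> t < d \<longrightarrow>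
       t - s \<le> \<sigma> * (\<phi> t - \<phi> s))"
proof -
  define G0 where "G0 t p \<longleftrightarrow> steepness C K F (fst p) (snd p) \<and> F (fst p) = c + t" for t p
  define G where "G t p \<longleftrightarrow> G0 t p \<and> (\<forall>p'. G0 t p' \<longrightarrow> snd p \<le> snd p')" for t p
  have saK: "semialg_pred (\<lambda>x. u x \<in> K)" if "semialg_fun u" for u :: "'c::euclidean_space \<Rightarrow> 'a"
    using semialg_subst[OF K(2) that] .
  note Fc = semialg_fun_compose[OF F(1)]
  have saG0: "semialg_pred (\<lambda>z. G0 (fst z) (snd z))"
    unfolding G0_def steepness_def by (intro semialg_intros saK Fc)
  have saG: "semialg_pred (\<lambda>z. G (fst z) (snd z))"
    unfolding G_def by (intro semialg_intros semialg_rel[OF saG0])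
  have clG0: "closed {p. G0 t p}" for t
  proof -
    define L where "L = {x \<in> K. F x = c + t}"
    have "L = K \<inter> F -` {c + t}" by (auto simp: L_def)
    then have "closed L"
      using continuous_closed_preimage[OF F(2) compact_imp_closed[OF K(1)]] by simp
    \<comment> \<open>On the level set \<open>F x\<close> is the constant \<open>c + t\<close>, so
      each remaining inequality is continuous in the pair of point and steepness.\<close>
    moreover have "{p. G0 t p} = (L \<times> {0..}) \<inter> (\<Inter>y\<in>K. {p. c + t - F y \<le>
        snd p * norm (y - fst p) + C * (norm (y - fst p) * norm (y - fst p))})"
      by (auto simp: G0_def steepness_def L_def)
    moreover have "closed (\<Inter>y\<in>K. {p. c + t - F y \<le>
        snd p * norm (y - fst p) + C * (norm (y - fst p) * norm (y - fst p))})"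
      by (intro closed_INT ballI closed_Collect_le continuous_intros)
    ultimately show ?thesis by (simp add: closed_Int closed_Times)
  qed
  \<comment> \<open>The steepness coordinate is unbounded; cutting it at the value of one admissible
    pair restores compactness without losing the minimum.\<close>
  have cut: "compact ({p. G0 t p} \<inter> K \<times> {0..r})" for t r
    by (intro closed_Int_compact clG0 compact_Times K(1) compact_Icc)
  have G0K: "p \<in> K \<times> {0..snd p}" if "G0 t p" for t p
    using that by (cases p) (auto simp: G0_def steepness_def)
  have exG: "\<exists>p. G t p" if p0: "G0 t p0" for t p0
  proof -
    have "{p. G0 t p} \<inter> K \<times> {0..snd p0} \<noteq> {}" using p0 G0K[OF p0] by blast
    then obtain p where p: "G0 t p" "p \<in> K \<times> {0..snd p0}"
        "\<And>q. G0 t q \<Longrightarrow> q \<in> K \<times> {0..snd p0} \<Longrightarrow> snd p \<le> snd q"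
      using continuous_attains_inf[OF cut, of t "snd p0" snd] continuous_on_snd[OF continuous_on_id]
      by (metis (no_types, lifting) IntD1 IntD2 IntI mem_Collect_eq id_apply)
    have "snd p \<le> snd q" if q: "G0 t q" for q
    proof (cases "snd q \<le> snd p0")
      case True
      then have "q \<in> K \<times> {0..snd p0}" using G0K[OF q] by (cases q) auto
      then show ?thesis using p(3) q by blast
    next
      case False
      then show ?thesis using p(2) by (cases p) auto
    qed
    then have "G t p" using p(1) unfolding G_def by blast
    then show ?thesis ..
  qed
  have "compact {p. G t p}" for t
  proof (cases "\<exists>p0. G0 t p0")
    case True
    then obtain p0 where p0: "G0 t p0" ..
    have "{p. G t p} = ({p. G0 t p} \<inter> K \<times> {0..snd p0}) \<inter> (\<Inter>q\<in>{q. G0 t q}. {p. snd p \<le> snd q})"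
      (is "_ = ?R")
    proof
      show "{p. G t p} \<subseteq> ?R"
      proof
        fix p assume "p \<in> {p. G t p}"
        then have p: "G0 t p" "\<And>q. G0 t q \<Longrightarrow> snd p \<le> snd q" unfolding G_def by blast+
        have "p \<in> K \<times> {0..snd p0}" using G0K[OF p(1)] p(2)[OF p0] by (cases p) auto
        then show "p \<in> ?R" using p by blast
      qed
      show "?R \<subseteq> {p. G t p}" unfolding G_def by blast
    qed
    moreover have "closed (\<Inter>q\<in>{q. G0 t q}. {p::'a \<times> real. snd p \<le> snd q})"
      by (intro closed_INT ballI closed_Collect_le continuous_intros)
    ultimately show ?thesis using cut by (simp add: compact_Int_closed)
  next
    case False
    then have "{p. G t p} = {}" by (auto simp: G_def)
    then show ?thesis by (simp only: compact_empty)
  qed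
  then obtain \<gamma> where \<gamma>: "semialg_fun \<gamma>" "\<And>t. (\<exists>p. G t p) \<Longrightarrow> G t (\<gamma> t)"
    using semialg_selection[OF saG] by blast
  have saE: "semialg_pred (\<lambda>t. \<exists>p. G0 t p)" by (intro semialg_intros saG0)
  \<comment> \<open>Either no level slightly above \<open>c\<close> has a point of finite steepness
    and the inequality is vacuous, or all of them have one and the curve exists.\<close>
  from semialg_eventually_at_right[OF this, of 0] show ?thesis
  proof
    assume "\<forall>\<^sub>F t in at_right 0. \<not> (\<exists>p. G0 t p)"
    then obtain d where d: "d > 0" "\<And>t. 0 < t \<Longrightarrow> t < d \<Longrightarrow> \<not> (\<exists>p. G0 t p)"
      unfolding eventually_at_right_field by blast
    have no: False if "steepness C K F x \<sigma>" "F x = c + t" "0 < s" "s \<le> t" "t < d" for x \<sigma> s t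
    proof -
      have "G0 t (x, \<sigma>)" using that by (simp add: G0_def)
      then show False using d(2)[of t] that by auto
    qed
    show ?thesis
      by (rule exI[of _ "\<lambda>t. 0"], rule exI[of _ d], rule exI[of _ 0]) (use d(1) no in auto)
  next
    assume "\<forall>\<^sub>F t in at_right 0. \<exists>p. G0 t p"
    then obtain d0 where d0: "d0 > 0" "\<And>t. 0 < t \<Longrightarrow> t < d0 \<Longrightarrow> \<exists>p. G0 t p"
      unfolding eventually_at_right_field by blast
    define x where "x t = fst (\<gamma> t)" for t
    define m where "m t = snd (\<gamma> t)" for t
    have G: "G t (x t, m t)" if "0 < t" "t < d0" for t
      using d0(2)[OF that] exG \<gamma>(2) by (auto simp: x_def m_def)
    have xK: "x t \<in> K" "F (x t) = c + t" "0 \<le> m t" if "0 < t" "t < d0" for t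
      using G[OF that] by (auto simp: G_def G0_def steepness_def)
    have steep: "F (x t) - F y \<le> m t * norm (y - x t) + C * (norm (y - x t) * norm (y - x t))"
      if "0 < t" "t < d0" "y \<in> K" for t y
      using G[OF that(1,2)] that(3) by (auto simp: G_def G0_def steepness_def)
    have least: "m t \<le> \<sigma>" if "steepness C K F y \<sigma>" "F y = c + t" "0 < t" "t < d0" for t y \<sigma>
    proof -
      have "G0 t (y, \<sigma>)" using that by (simp add: G0_def)
      then show ?thesis using G[OF that(3,4)] by (force simp: G_def)
    qed
    have "semialg_fun (\<lambda>t. x t \<bullet> b)" for b
      unfolding x_def by (intro semialg_intros \<gamma>(1))
    then have "\<exists>e d. \<bar>e\<bar> = 1 \<and> d > 0 \<and> (\<forall>t. 0 < t \<longrightarrow> t < d \<longrightarrow> isCont (\<lambda>t. x t \<bullet> b) t) \<and>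
      (\<forall>s t. 0 < s \<longrightarrow> s \<le> t \<longrightarrow> t < d \<longrightarrow> e * (x s \<bullet> b) \<le> e * (x t \<bullet> b))" for b
      using semialg_fun_eventually_mono[of "\<lambda>t. x t \<bullet> b"] by blast
    then obtain e d1 where e: "\<And>b. \<bar>e b\<bar> = 1" "\<And>b. d1 b > (0::real)"
      "\<And>b t. 0 < t \<Longrightarrow> t < d1 b \<Longrightarrow> isCont (\<lambda>t. x t \<bullet> b) t"
      "\<And>b s t. 0 < s \<Longrightarrow> s \<le> t \<Longrightarrow> t < d1 b \<Longrightarrow> e b * (x s \<bullet> b) \<le> e b * (x t \<bullet> b)"
      by metis
    have "semialg_fun m" unfolding m_def[abs_def] by (intro semialg_intros \<gamma>(1))
    then obtain em d2 where em: "\<bar>em\<bar> = 1" "d2 > 0"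
      "\<And>s t. 0 < s \<Longrightarrow> s \<le> t \<Longrightarrow> t < d2 \<Longrightarrow> em * m s \<le> em * m t"
      using semialg_fun_eventually_mono[of m] by blast
    define d where "d = min (min d0 d2) (Min (d1 ` Basis))"
    have d: "d > 0" "d \<le> d0" "d \<le> d2" "\<And>b. b \<in> Basis \<Longrightarrow> d \<le> d1 b"
      using d0(1) em(2) e(2) by (auto simp: d_def min_le_iff_disj)
    define \<phi> where "\<phi> t = (\<Sum>b\<in>Basis. e b * (x t \<bullet> b))" for t
    have dist: "norm (x t - x s) \<le> \<phi> t - \<phi> s" if st: "0 < s" "s \<le> t" "t < d" for s t
    proof -
      have "\<bar>(x t - x s) \<bullet> b\<bar> = e b * (x t \<bullet> b) - e b * (x s \<bullet> b)" if b: "b \<in> Basis" for b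
      proof -
        have le: "e b * (x s \<bullet> b) \<le> e b * (x t \<bullet> b)" using e(4)[of s t b] st d(4)[OF b] by auto
        have "\<bar>(x t - x s) \<bullet> b\<bar> = \<bar>e b * ((x t - x s) \<bullet> b)\<bar>" by (simp add: abs_mult e(1))
        also have "\<dots> = \<bar>e b * (x t \<bullet> b) - e b * (x s \<bullet> b)\<bar>" by (simp add: inner_diff_left algebra_simps)
        finally show ?thesis using le by simp
      qed
      from norm_le_variation[OF this] show ?thesis by (simp add: \<phi>_def sum_subtractf)
    qed
    have cont: "isCont \<phi> t" if "0 < t" "t < d" for t
      unfolding \<phi>_def[abs_def]
      by (intro continuous_intros e(3)) (use that d(4) in force)+
    obtain R where R: "\<And>y. y \<in> K \<Longrightarrow> norm y \<le> R"
      using compact_imp_bounded[OF K(1)] by (auto simp: bounded_iff)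
    have bound: "- (\<Sum>b\<in>(Basis::'a set). R) \<le> \<phi> t" if "0 < t" "t < d" for t
    proof -
      have "- R \<le> e b * (x t \<bullet> b)" if "b \<in> Basis" for b
      proof -
        have "\<bar>e b * (x t \<bullet> b)\<bar> \<le> R"
          using Basis_le_norm[OF \<open>b \<in> Basis\<close>, of "x t"] R[OF xK(1)[of t]] \<open>0 < t\<close> \<open>t < d\<close> d(2)
          by (simp add: abs_mult e(1))
        then show ?thesis by linarith
      qed
      then have "(\<Sum>b\<in>(Basis::'a set). - R) \<le> \<phi> t" unfolding \<phi>_def by (intro sum_mono)
      then show ?thesis by (simp add: sum_negf)
    qed
    \<comment> \<open>A derivative-free form of \<open>1 \<le> M * \<phi>'\<close>: the point
      \<open>x t\<close> is compared with the earlier curve point \<open>x s\<close>, whose level is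
      lower by \<open>t - s\<close>. The term with \<open>C\<close> is quadratic in the increment of
      \<open>\<phi>\<close>, and by continuity the slack \<open>M - m t\<close> absorbs it.\<close>
    have local: "\<forall>\<^sub>F s in at_left t. M * \<phi> s - s \<le> M * \<phi> t - t" if t: "0 < t" "t < d" "m t < M" for t M
    proof -
      have "(\<phi> \<longlongrightarrow> \<phi> t) (at_left t)"
        using cont[OF t(1,2)] unfolding isCont_def by (rule tendsto_within_subset) simp
      then have "((\<lambda>s. \<bar>C\<bar> * (\<phi> t - \<phi> s)) \<longlongrightarrow> \<bar>C\<bar> * (\<phi> t - \<phi> t)) (at_left t)"
        by (intro tendsto_intros)
      then have "\<forall>\<^sub>F s in at_left t. \<bar>C\<bar> * (\<phi> t - \<phi> s) < M - m t"
        by (rule order_tendstoD(2)) (use t(3) in simp)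
      moreover have "\<forall>\<^sub>F s in at_left t. 0 < s \<and> s < t"
        using t(1) unfolding eventually_at_left_field by blast
      ultimately show ?thesis
      proof eventually_elim
        case (elim s)
        define r where "r = norm (x s - x t)"
        define q where "q = \<phi> t - \<phi> s"
        have r: "0 \<le> r" "r \<le> q" using dist[of s t] elim t by (auto simp: r_def q_def norm_minus_commute)
        have td: "t < d0" "s < d0" using t d elim by auto
        have "t - s \<le> m t * r + C * (r * r)"
          using steep[of t "x s"] xK(1)[of s] xK(2)[of s] xK(2)[of t] td t elim by (simp add: r_def)
        also have "\<dots> \<le> m t * q + \<bar>C\<bar> * (q * q)"
        proof (intro add_mono mult_mono)
          show "0 \<le> m t" using xK(3) t td by auto
        qed (use r in auto)
        also have "\<dots> = (m t + \<bar>C\<bar> * q) * q" by (simp add: algebra_simps)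
        also have "\<dots> \<le> M * q" using elim r by (intro mult_right_mono) (auto simp: q_def)
        finally show ?case by (simp add: q_def algebra_simps)
      qed
    qed
    \<comment> \<open>For nondecreasing \<open>m\<close> one constant above \<open>m t\<close>
      serves all levels below \<open>t\<close>. For nonincreasing \<open>m\<close> that is positive
      at \<open>t0\<close>, the steepness below \<open>t0\<close> is at least \<open>m t0\<close>,
      and a linear desingularising function does. If \<open>m\<close> vanishes throughout, it counts
      as nondecreasing.\<close>
    consider (mono) "\<And>s t. 0 < s \<Longrightarrow> s \<le> t \<Longrightarrow> t < d \<Longrightarrow> m s \<le> m t"
      | (pos) t0 where "0 < t0" "t0 < d" "0 < m t0" "\<And>t. 0 < t \<Longrightarrow> t \<le> t0 \<Longrightarrow> m t0 \<le> m t"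
    proof (cases "em = 1")
      case True
      then show ?thesis using em(3) d(3) by (intro mono) auto
    next
      case False
      then have anti: "m t \<le> m s" if "0 < s" "s \<le> t" "t < d" for s t
        using em(1) em(3)[of s t] that d(3) by (auto simp: abs_if split: if_splits)
      show ?thesis
      proof (cases "\<exists>t0. 0 < t0 \<and> t0 < d \<and> 0 < m t0")
        case True
        then show ?thesis using anti pos by blast
      next
        case False
        then have "m t = 0" if "0 < t" "t < d" for t using xK(3)[of t] that d(2) by force
        then show ?thesis by (intro mono) auto
      qed
    qed
    then show ?thesis
    proof cases
      case mono
      have main: "t - s \<le> \<sigma> * (\<phi> t - \<phi> s)"
        if y: "steepness C K F y \<sigma>" "F y = c + t" and st: "0 < s" "s \<le> t" "t < d" for y \<sigma> s t
      proof (rule field_le_epsilon)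
        fix \<epsilon> :: real assume \<epsilon>: "0 < \<epsilon>"
        have q: "0 \<le> \<phi> t - \<phi> s" using dist[OF st] norm_ge_zero order_trans by blast
        \<comment> \<open>The slack makes \<open>m t < M\<close> strict, as \<open>local\<close>
          demands, and costs at most \<open>\<epsilon>\<close> in the end; the added 1 avoids
          division by zero when \<open>\<phi> t = \<phi> s\<close>.\<close>
        define M where "M = \<sigma> + \<epsilon> / (\<phi> t - \<phi> s + 1)"
        have "m t \<le> \<sigma>" using least[OF y] st d(2) by auto
        then have M: "m t < M" using \<epsilon> q by (simp add: M_def add_strict_increasing2 less_add_same_cancel1 order_le_less_trans)
        have "M * \<phi> s - s \<le> M * \<phi> t - t"
        proof (rule le_of_eventually_at_left_le[OF st(2), of "\<lambda>r. M * \<phi> r - r"])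
          show "continuous_on {s..t} (\<lambda>r. M * \<phi> r - r)"
            by (intro continuous_intros continuous_at_imp_continuous_on ballI cont) (use st in auto)
          show "\<forall>\<^sub>F r' in at_left r. M * \<phi> r' - r' \<le> M * \<phi> r - r" if "s < r" "r \<le> t" for r
            by (rule local) (use that st mono[of r t] M in auto)
        qed
        then have "t - s \<le> M * (\<phi> t - \<phi> s)" by (simp add: algebra_simps)
        also have "\<dots> = \<sigma> * (\<phi> t - \<phi> s) + \<epsilon> * ((\<phi> t - \<phi> s) / (\<phi> t - \<phi> s + 1))"
          by (simp add: M_def algebra_simps)
        also have "\<dots> \<le> \<sigma> * (\<phi> t - \<phi> s) + \<epsilon> * 1"
          using \<epsilon> q by (intro add_left_mono mult_left_mono) (auto simp: divide_le_eq)
        finally show "t - s \<le> \<sigma> * (\<phi> t - \<phi> s) + \<epsilon>" by simp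
      qed
      show ?thesis
      proof (rule exI[of _ \<phi>], rule exI[of _ d], rule exI[of _ "- (\<Sum>b\<in>(Basis::'a set). R)"],
          intro conjI allI impI)
        show "0 < d" by (rule d(1))
        show "- (\<Sum>b\<in>(Basis::'a set). R) \<le> \<phi> t" if "0 < t" "t < d" for t using that by (rule bound)
        show "\<phi> s \<le> \<phi> t" if "0 < s" "s \<le> t" "t < d" for s t
          using dist[OF that] norm_ge_zero[of "x t - x s"] by linarith
        show "t - s \<le> \<sigma> * (\<phi> t - \<phi> s)"
          if "steepness C K F y \<sigma>" "F y = c + t" "0 < s" "s \<le> t" "t < d" for y \<sigma> s t
          using that by (rule main)
      qed
    next
      case (pos t0)
      have main: "t - s \<le> \<sigma> * (t / m t0 - s / m t0)"
        if y: "steepness C K F y \<sigma>" "F y = c + t" and st: "0 < s" "s \<le> t" "t < t0" for y \<sigma> s t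
      proof -
        have "m t0 \<le> \<sigma>" using least[OF y] pos(4)[of t] pos(2) st d(2) by auto
        then have "m t0 * ((t - s) / m t0) \<le> \<sigma> * ((t - s) / m t0)"
          using pos(3) st by (intro mult_right_mono) auto
        moreover have "m t0 * ((t - s) / m t0) = t - s" using pos(3) by simp
        ultimately show ?thesis by (simp add: diff_divide_distrib)
      qed
      show ?thesis
      proof (rule exI[of _ "\<lambda>t. t / m t0"], rule exI[of _ t0], rule exI[of _ 0], intro conjI allI impI)
        show "0 < t0" by (rule pos(1))
        show "0 \<le> t / m t0" if "0 < t" for t using that pos(3) by simp
        show "s / m t0 \<le> t / m t0" if "s \<le> t" for s t using that pos(3) by (simp add: divide_right_mono)
        show "t - s \<le> \<sigma> * (t / m t0 - s / m t0)"
          if "steepness C K F y \<sigma>" "F y = c + t" "0 < s" "s \<le> t" "t < t0" for y \<sigma> s t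
          using that by (rule main)
      qed
    qed
  qed
qed


text \<open>The square of a step is at most a constant times the previous step times a drop of
  \<open>\<phi>\<close>. The inequality of arithmetic and geometric means makes this linear and
  telescoping, so the steps are summable.\<close>

lemma steepness_descent_convergent:
  fixes K :: "'a::euclidean_space set" and F :: "'a \<Rightarrow> real" and x :: "nat \<Rightarrow> 'a"
  assumes K: "compact K" "semialg_pred (\<lambda>x. x \<in> K)" and F: "semialg_fun F" "continuous_on K F"
    and xK: "\<And>k. x k \<in> K"
    and a: "0 < a" "\<And>k. a * (norm (x (Suc k) - x k))\<^sup>2 \<le> F (x k) - F (x (Suc k))"
    and b: "0 \<le> b" "\<And>k. steepness C K F (x (Suc k)) (b * norm (x (Suc k) - x k))"
  shows "convergent x"
proof -
  define \<delta> where "\<delta> k = norm (x (Suc k) - x k)" for k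
  have dec: "decseq (\<lambda>k. F (x k))"
  proof (rule decseq_SucI)
    fix k
    have "0 \<le> a * (norm (x (Suc k) - x k))\<^sup>2" using a(1) by simp
    then show "F (x (Suc k)) \<le> F (x k)" using a(2)[of k] by linarith
  qed
  have "bounded (F ` K)" using compact_imp_bounded[OF compact_continuous_image[OF F(2) K(1)]] .
  then obtain B0 where "\<And>y. y \<in> K \<Longrightarrow> \<bar>F y\<bar> \<le> B0" by (auto simp: bounded_iff)
  then have "- B0 \<le> F (x k)" for k using xK[of k] by (metis abs_le_D2 minus_le_iff)
  then obtain c where c: "(\<lambda>k. F (x k)) \<longlonglongrightarrow> c" "\<And>k. c \<le> F (x k)"
    using decseq_convergent[OF dec] by metis
  have "summable \<delta>"
  \<comment> \<open>The Kurdyka--Lojasiewicz inequality concerns levels strictly above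
    \<open>c\<close>. Once the limit value is attained, sufficient decrease stops the
    sequence.\<close>
  proof (cases "\<exists>N. F (x N) = c")
    case True
    then obtain N where N: "F (x N) = c" ..
    have "F (x k) = c" if "N \<le> k" for k
      using decseqD[OF dec that] c(2)[of k] N by linarith
    then have "a * (\<delta> k)\<^sup>2 \<le> 0" if "N \<le> k" for k
      using a(2)[of k] that by (simp add: \<delta>_def)
    then have "\<delta> k = 0" if "N \<le> k" for k
      using that a(1) by (metis mult_le_0_iff not_less power2_less_eq_zero_iff)
    then have "\<delta> k = 0" if "k \<notin> {..<N}" for k using that by simp
    then show ?thesis by (intro summable_finite[of "{..<N}"]) auto
  next
    case False
    define t where "t k = F (x k) - c" for k
    have tpos: "0 < t k" for k using False c(2)[of k] by (auto simp: t_def less_le)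
    obtain \<phi> d B where kl: "0 < d" "\<And>t. 0 < t \<Longrightarrow> t < d \<Longrightarrow> B \<le> \<phi> t"
      "\<And>s t. 0 < s \<Longrightarrow> s \<le> t \<Longrightarrow> t < d \<Longrightarrow> \<phi> s \<le> \<phi> t"
      "\<And>x \<sigma> s t. steepness C K F x \<sigma> \<Longrightarrow> F x = c + t \<Longrightarrow> 0 < s \<Longrightarrow> s \<le> t \<Longrightarrow> t < d \<Longrightarrow>
       t - s \<le> \<sigma> * (\<phi> t - \<phi> s)"
      using kurdyka_lojasiewicz[OF K F, of C c] by blast
    have "\<forall>\<^sub>F k in sequentially. F (x k) < c + d"
      by (rule order_tendstoD(2)[OF c(1)]) (use kl(1) in simp)
    then obtain N where N: "\<And>k. N \<le> k \<Longrightarrow> t k < d"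
      unfolding eventually_sequentially t_def by (metis add.commute less_diff_eq diff_less_eq)
    define e where "e = b / a"
    \<comment> \<open>The index is shifted by one because the steepness at a point is bounded by the
      step leading to it, while the drop in level belongs to the step leaving it.\<close>
    define \<Phi> where "\<Phi> k = \<phi> (t (Suc (N + k)))" for k
    have step: "2 * \<delta> (Suc (N + k)) \<le> \<delta> (N + k) + e * (\<Phi> k - \<Phi> (Suc k))" for k
    proof -
      define q where "q = \<Phi> k - \<Phi> (Suc k)"
      have "t (Suc (N + k)) - t (Suc (Suc (N + k))) \<le> (b * \<delta> (N + k)) * q"
        unfolding q_def \<Phi>_def add_Suc_right
      proof (rule kl(4))
        show "steepness C K F (x (Suc (N + k))) (b * \<delta> (N + k))" using b(2) by (simp add: \<delta>_def)
        show "t (Suc (Suc (N + k))) \<le> t (Suc (N + k))" using decseq_SucD[OF dec] by (simp add: t_def)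
        show "t (Suc (N + k)) < d" by (rule N) simp
      qed (use tpos in \<open>simp_all add: t_def\<close>)
      then have "a * (\<delta> (Suc (N + k)))\<^sup>2 \<le> b * \<delta> (N + k) * q"
        using a(2)[of "Suc (N + k)"] by (simp add: t_def \<delta>_def)
      then have sq: "(\<delta> (Suc (N + k)))\<^sup>2 \<le> \<delta> (N + k) * (e * q)"
        using a(1) by (simp add: e_def field_simps)
      have nn: "0 \<le> \<delta> (Suc (N + k))" "0 \<le> \<delta> (N + k)" by (simp_all add: \<delta>_def)
      have "\<Phi> (Suc k) \<le> \<Phi> k"
        unfolding \<Phi>_def by (rule kl(3)) (use tpos N decseq_SucD[OF dec] in \<open>simp_all add: t_def\<close>)
      then have eq: "0 \<le> e * q" using a(1) b(1) by (simp add: e_def q_def)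
      have "(2 * \<delta> (Suc (N + k)))\<^sup>2 \<le> 4 * (\<delta> (N + k) * (e * q))" using sq by (simp add: power_mult_distrib)
      also have "\<dots> \<le> (\<delta> (N + k) + e * q)\<^sup>2"
        using zero_le_power2[of "\<delta> (N + k) - e * q"] by (simp add: power2_eq_square algebra_simps)
      finally show ?thesis unfolding q_def[symmetric]
        by (rule power2_le_imp_le) (use nn eq in simp)
    qed
    \<comment> \<open>Of the two copies of \<open>\<delta> (N + n)\<close> carried on the left, one
      joins the sum and the other pays for the right-hand side of \<open>step\<close>.\<close>
    have sum: "(\<Sum>k<n. \<delta> (N + k)) + 2 * \<delta> (N + n) \<le> 2 * \<delta> N + e * (\<Phi> 0 - \<Phi> n)" for n
    proof (induction n)
      case (Suc n)
      then show ?case using step[of n] by (simp add: algebra_simps)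
    qed simp
    have "(\<Sum>k<n. \<delta> (N + k)) \<le> 2 * \<delta> N + e * (\<Phi> 0 - B)" for n
    proof -
      have "B \<le> \<Phi> n" unfolding \<Phi>_def by (rule kl(2)) (use tpos N in simp_all)
      then have "e * (\<Phi> 0 - \<Phi> n) \<le> e * (\<Phi> 0 - B)"
        using a(1) b(1) by (intro mult_left_mono) (simp_all add: e_def)
      moreover have "0 \<le> \<delta> (N + n)" by (simp add: \<delta>_def)
      ultimately show ?thesis using sum[of n] by linarith
    qed
    then have "summable (\<lambda>k. \<delta> (N + k))"
      by (intro summableI_nonneg_bounded) (simp_all add: \<delta>_def)
    then show ?thesis using summable_iff_shift[of \<delta> N] by (simp add: add.commute)
  qed
  then have "summable (\<lambda>k. x (Suc k) - x k)" unfolding \<delta>_def by (rule summable_norm_cancel)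
  then have "convergent (\<lambda>n. \<Sum>k<n. x (Suc k) - x k)" by (simp add: summable_iff_convergent)
  then have "convergent (\<lambda>n. x n - x 0)" by (simp add: sum_lessThan_telescope)
  then have "convergent (\<lambda>n. (x n - x 0) + x 0)" by (rule convergent_add) (rule convergent_const)
  then show ?thesis by simp
qed

section \<open>Gradients, projections and subdifferentials\<close>

lemma semialg_fun_divide:
  assumes "semialg_fun u" "semialg_fun v" shows "semialg_fun (\<lambda>x. u x / v x :: real)"
proof -
  have "(y = p / q) \<longleftrightarrow> (q \<noteq> 0 \<and> y * q = p) \<or> (q = 0 \<and> y = 0)" for y p q :: real
    by (auto simp: field_simps)
  moreover have "semialg_pred (\<lambda>z. (v (fst z) \<noteq> 0 \<and> snd z * v (fst z) = u (fst z)) \<or> (v (fst z) = 0 \<and> snd z = 0))"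
    by (intro semialg_intros semialg_fun_compose[OF assms(1)] semialg_fun_compose[OF assms(2)])
  ultimately show ?thesis by (simp add: semialg_fun_def)
qed

text \<open>Extension by zero: \<open>f\<close> is controlled only on \<open>S\<close>, whereas
  \<open>semialg_fun\<close> speaks of total functions.\<close>

lemma semialg_fun_restrict:
  assumes K: "semialg_pred (\<lambda>x. x \<in> K)" "K \<subseteq> S" and f: "semi_algebraic_fun_on S (\<lambda>x. ereal (f x))"
  shows "semialg_fun (\<lambda>x. if x \<in> K then f x else 0)"
proof -
  have G: "semialg_pred (\<lambda>w. w \<in> {(x, y::real). x \<in> S \<and> ereal y = ereal (f x)})"
    using f unfolding semi_algebraic_fun_on_def by (rule semialg_mem_semi_algebraic)
  have "semialg_pred (\<lambda>w. fst w \<in> K \<and> w \<in> {(x, y::real). x \<in> S \<and> ereal y = ereal (f x)} \<or> fst w \<notin> K \<and> snd w = 0)"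
    by (intro semialg_intros G semialg_subst[OF K(1)])
  moreover have "(fst w \<in> K \<and> w \<in> {(x, y::real). x \<in> S \<and> ereal y = ereal (f x)} \<or> fst w \<notin> K \<and> snd w = 0)
     \<longleftrightarrow> snd w = (if fst w \<in> K then f (fst w) else 0)" for w
    using K(2) by (auto simp: split_beta)
  ultimately show ?thesis by (simp add: semialg_fun_def)
qed

lemma GDERIV_unique:
  assumes "GDERIV f x :> D" "GDERIV f x :> E" shows "D = E"
proof -
  have "(\<lambda>h. h \<bullet> D) = (\<lambda>h. h \<bullet> E)"
    using assms unfolding gderiv_def by (rule has_derivative_unique)
  then have "(D - E) \<bullet> (D - E) = 0" by (metis inner_diff_right right_minus_eq)
  then show ?thesis by simp
qed

lemma grad_eq: "GDERIV f x :> D \<Longrightarrow> grad f x = D"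
  unfolding grad_def using GDERIV_unique by blast

lemma GDERIV_grad:
  fixes f :: "'a::euclidean_space \<Rightarrow> real"
  assumes "f differentiable (at x)" shows "GDERIV f x :> grad f x"
proof -
  obtain f' where f': "(f has_derivative f') (at x)" using assms by (auto simp: differentiable_def)
  interpret bounded_linear f' by (rule has_derivative_bounded_linear[OF f'])
  have "f' h = h \<bullet> (\<Sum>b\<in>Basis. f' b *\<^sub>R b)" for h
  proof -
    have "f' h = f' (\<Sum>b\<in>Basis. (h \<bullet> b) *\<^sub>R b)" by (simp add: euclidean_representation)
    also have "\<dots> = (\<Sum>b\<in>Basis. (h \<bullet> b) * f' b)" by (simp add: sum scaleR)
    finally show ?thesis by (simp add: inner_sum_right mult.commute)
  qed
  then have "f' = (\<lambda>h. h \<bullet> (\<Sum>b\<in>Basis. f' b *\<^sub>R b))" by blast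
  then have "GDERIV f x :> (\<Sum>b\<in>Basis. f' b *\<^sub>R b)" using f' unfolding gderiv_def by simp
  then show ?thesis using grad_eq by metis
qed

text \<open>The mean value theorem on the segment gives the constant \<open>L\<close> in place of
  the sharp \<open>L / 2\<close>; step sizes below \<open>1 / L\<close> still yield decrease with
  it.\<close>

lemma gradient_quadratic_bound:
  fixes h :: "'a::euclidean_space \<Rightarrow> real"
  assumes S: "convex S" "x \<in> S" "y \<in> S"
    and G: "\<And>z. z \<in> S \<Longrightarrow> GDERIV h z :> G z" and L: "L-lipschitz_on S G"
  shows "\<bar>h y - h x - G x \<bullet> (y - x)\<bar> \<le> L * (norm (y - x))\<^sup>2"
proof -
  define p where "p s = x + s *\<^sub>R (y - x)" for s :: real
  have pS: "p s \<in> S" if "0 \<le> s" "s \<le> 1" for s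
  proof -
    have "p s = (1 - s) *\<^sub>R x + s *\<^sub>R y" by (simp add: p_def algebra_simps)
    then show ?thesis using convexD_alt[OF S that] by simp
  qed
  have der: "DERIV (\<lambda>s. h (p s)) s :> G (p s) \<bullet> (y - x)" if "0 \<le> s" "s \<le> 1" for s
  proof -
    have "(p has_derivative (\<lambda>s. s *\<^sub>R (y - x))) (at s)"
      unfolding p_def by (auto intro!: derivative_eq_intros)
    from has_derivative_compose[OF this G[OF pS[OF that], unfolded gderiv_def]]
    show ?thesis by (simp add: has_field_derivative_def inner_commute mult.commute[of _ "G (p s) \<bullet> (y - x)"])
  qed
  obtain s where s: "0 < s" "s < 1" "h (p 1) - h (p 0) = (1 - 0) * (G (p s) \<bullet> (y - x))"
    using MVT2[of 0 1 "\<lambda>s. h (p s)" "\<lambda>s. G (p s) \<bullet> (y - x)"] der by auto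
  have "h y - h x - G x \<bullet> (y - x) = (G (p s) - G x) \<bullet> (y - x)"
    using s(3) by (simp add: p_def inner_diff_left)
  also have "\<bar>\<dots>\<bar> \<le> norm (G (p s) - G x) * norm (y - x)" by (rule Cauchy_Schwarz_ineq2)
  also have "\<dots> \<le> (L * norm (y - x)) * norm (y - x)"
  proof (rule mult_right_mono)
    have "norm (G (p s) - G x) \<le> L * norm (p s - x)"
      using lipschitz_onD[OF L pS[of s] S(2)] s by (simp add: dist_norm)
    also have "norm (p s - x) \<le> norm (y - x)" using s by (simp add: p_def mult_left_le_one_le)
    finally show "norm (G (p s) - G x) \<le> L * norm (y - x)"
      using lipschitz_on_nonneg[OF L] by (simp add: mult_left_mono)
  qed simp
  finally show ?thesis by (simp add: power2_eq_square mult.assoc)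
qed

lemma le_of_linear_perturbation:
  fixes A B D e :: real
  assumes "0 < e" "\<And>s. 0 < s \<Longrightarrow> s < e \<Longrightarrow> A \<le> B + s * D"
  shows "A \<le> B"
proof (rule tendsto_le[OF trivial_limit_at_right_real _ tendsto_const])
  show "((\<lambda>s. B + s * D) \<longlongrightarrow> B) (at_right 0)"
    by (rule tendsto_eq_intros refl | simp)+
  show "\<forall>\<^sub>F s in at_right 0. A \<le> B + s * D"
    unfolding eventually_at_right_field using assms by auto
qed

text \<open>At the point with parameter \<open>s\<close> on the segment, convexity and the quadratic
  bound give the tangent inequality with an error proportional to \<open>s\<close>, which then tends
  to 0.\<close>

lemma convex_gradient_bound:
  fixes h :: "'a::euclidean_space \<Rightarrow> real"
  assumes S: "convex S" "x \<in> S" "y \<in> S" and h: "convex_on S h"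
    and G: "\<And>z. z \<in> S \<Longrightarrow> GDERIV h z :> G z" and L: "L-lipschitz_on S G"
  shows "h x + G x \<bullet> (y - x) \<le> h y"
proof (rule le_of_linear_perturbation[of 1])
  fix s :: real assume s: "0 < s" "s < 1"
  define p where "p = (1 - s) *\<^sub>R x + s *\<^sub>R y"
  have p: "p - x = s *\<^sub>R (y - x)" by (simp add: p_def algebra_simps)
  have "p \<in> S" using convexD_alt[OF S, of s] s by (simp add: p_def)
  then have "G x \<bullet> (p - x) - L * (norm (p - x))\<^sup>2 \<le> h p - h x"
    using gradient_quadratic_bound[OF S(1,2) _ G L, of p] by force
  also have "h p \<le> (1 - s) * h x + s * h y"
    unfolding p_def using convex_onD[OF h, of s x y] S s by simp
  finally have le: "G x \<bullet> (p - x) - L * (norm (p - x))\<^sup>2 \<le> (1 - s) * h x + s * h y - h x" by simp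
  define I N where "I = G x \<bullet> (y - x)" and "N = (norm (y - x))\<^sup>2"
  have "G x \<bullet> (p - x) = s * I" "(norm (p - x))\<^sup>2 = s * s * N"
    by (simp_all add: p I_def N_def power_mult_distrib power2_eq_square)
  then have "s * (I - s * (L * N)) \<le> s * (h y - h x)" using le by (simp add: algebra_simps)
  then have "G x \<bullet> (y - x) - s * (L * (norm (y - x))\<^sup>2) \<le> h y - h x" using s by (simp add: I_def N_def)
  then show "h x + G x \<bullet> (y - x) \<le> h y + s * (L * (norm (y - x))\<^sup>2)" by simp
qed simp

text \<open>The point \<open>z\<close> supplies a finite value of the objective, which excludes
  minimisers outside \<open>S\<close>.\<close>

lemma prox_set_indicator:
  assumes "u \<in> prox (set_indicator S) y" "z \<in> S"
  shows "u \<in> S" "\<And>w. w \<in> S \<Longrightarrow> dist y u \<le> dist y w"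
proof -
  define q where "q u = ereal (1/2 * (norm (u - y))\<^sup>2) + set_indicator S u" for u
  have min: "\<not> q w < q u" for w
    using assms(1) by (simp add: prox_def is_arg_min_def q_def)
  have q: "q w = ereal (1/2 * (norm (w - y))\<^sup>2)" if "w \<in> S" for w
    using that by (simp add: q_def set_indicator_def)
  show u: "u \<in> S"
  proof (rule ccontr)
    assume "u \<notin> S"
    then have "q u = \<infinity>" by (simp add: q_def set_indicator_def)
    then show False using min[of z] q[OF assms(2)] by simp
  qed
  show "dist y u \<le> dist y w" if "w \<in> S" for w
  proof -
    have "(norm (u - y))\<^sup>2 \<le> (norm (w - y))\<^sup>2" using min[of w] q[OF that] q[OF u] by (simp add: not_less)
    then show ?thesis by (metis dist_commute dist_norm norm_ge_zero power2_le_imp_le)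
  qed
qed

lemma frechet_subdiff_0I:
  fixes F :: "'a::real_inner \<Rightarrow> ereal"
  assumes r: "0 < r" and fin: "F x = ereal a"
    and lower: "\<And>y. dist y x < r \<Longrightarrow> F y \<noteq> \<infinity> \<Longrightarrow> \<exists>b. F y = ereal b \<and> a - b \<le> C * (norm (y - x))\<^sup>2"
  shows "0 \<in> frechet_subdiff F x"
proof -
  have "0 \<le> Liminf (at x) (\<lambda>y. (F y - F x - ereal (inner 0 (y - x))) / ereal (norm (y - x)))"
    unfolding le_Liminf_iff
  proof (intro allI impI)
    fix e :: ereal assume "e < 0"
    then obtain e' where e': "e < ereal e'" "ereal e' < 0" using ereal_dense2 by blast
    \<comment> \<open>With \<open>n = norm (y - x)\<close> the quotient is at least
      \<open>- C * n\<close>, which exceeds \<open>e'\<close> within this radius. The absolute value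
      and the added 1 cover negative and zero \<open>C\<close>.\<close>
    define d where "d = min r (- e' / (\<bar>C\<bar> + 1))"
    have d: "0 < d" using r e'(2) by (simp add: d_def divide_neg_pos add_nonneg_pos)
    show "\<forall>\<^sub>F y in at x. e < (F y - F x - ereal (inner 0 (y - x))) / ereal (norm (y - x))"
      unfolding eventually_at
    proof (intro exI[of _ d] conjI d ballI impI)
      fix y assume y: "y \<noteq> x \<and> dist y x < d"
      define n where "n = norm (y - x)"
      have n: "0 < n" using y by (simp add: n_def)
      show "e < (F y - F x - ereal (inner 0 (y - x))) / ereal (norm (y - x))"
      proof (cases "F y = \<infinity>")
        case True
        moreover have "e \<noteq> \<infinity>" using e'(1) by auto
        ultimately show ?thesis using n by (simp add: fin n_def[symmetric])
      next
        case False
        then obtain b where b: "F y = ereal b" "a - b \<le> C * n\<^sup>2"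
          using lower[of y] y by (auto simp: d_def n_def)
        have "n < - e' / (\<bar>C\<bar> + 1)" using y by (simp add: d_def n_def dist_norm)
        moreover have "0 < \<bar>C\<bar> + 1" by (simp add: add_nonneg_pos)
        ultimately have "n * (\<bar>C\<bar> + 1) < - e'" by (simp only: pos_less_divide_eq)
        moreover have "C * n \<le> n * (\<bar>C\<bar> + 1)"
        proof -
          have "C * n \<le> (\<bar>C\<bar> + 1) * n" using n by (intro mult_right_mono) auto
          then show ?thesis by (simp only: mult.commute)
        qed
        ultimately have "C * n < - e'" by linarith
        then have "C * n * n < - e' * n" using n by (intro mult_strict_right_mono)
        then have "e' * n < b - a" using b(2) by (simp add: power2_eq_square)
        then have "e' < (b - a) / n" using n by (simp add: pos_less_divide_eq)
        then have "ereal e' < (F y - F x - ereal (inner 0 (y - x))) / ereal (norm (y - x))"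
          using n by (simp add: fin b n_def[symmetric])
        then show ?thesis using e'(1) by (rule order_less_trans[rotated])
      qed
    qed
  qed
  then show ?thesis by (simp add: frechet_subdiff_def effective_dom_def fin)
qed

text \<open>On the segment towards \<open>y\<close> the error is quadratic in the parameter
  \<open>s\<close>, while convexity bounds \<open>h\<close> by \<open>s * h y\<close>. Division by
  \<open>s\<close> makes the error vanish in the limit, and only small \<open>s\<close> are
  involved.\<close>

lemma convex_local_quadratic_min:
  fixes h :: "'a::real_inner \<Rightarrow> real"
  assumes h: "convex_on S h" "convex S" "x \<in> S" "y \<in> S" "h x = 0" and r: "0 < r"
    and loc: "\<And>z. z \<in> S \<Longrightarrow> dist z x < r \<Longrightarrow> - C * (norm (z - x))\<^sup>2 \<le> h z"
  shows "0 \<le> h y"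
proof (rule le_of_linear_perturbation)
  show "0 < min 1 (r / (norm (y - x) + 1))" using r by (simp add: add_nonneg_pos)
  fix s assume s: "0 < s" "s < min 1 (r / (norm (y - x) + 1))"
  define p where "p = (1 - s) *\<^sub>R x + s *\<^sub>R y"
  have p: "p - x = s *\<^sub>R (y - x)" by (simp add: p_def algebra_simps)
  have pS: "p \<in> S" using convexD_alt[OF h(2-4), of s] s by (simp add: p_def)
  have "s * (norm (y - x) + 1) < r" using s by (simp add: pos_less_divide_eq add_nonneg_pos)
  moreover have "dist p x = s * norm (y - x)" using s p by (simp add: dist_norm)
  ultimately have "dist p x < r" using s by (simp add: algebra_simps)
  then have "- C * (norm (p - x))\<^sup>2 \<le> h p" by (rule loc[OF pS])
  also have "h p \<le> s * h y"
    unfolding p_def using convex_onD[OF h(1), of s x y] h(3-5) s by simp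
  finally have le: "- C * (norm (p - x))\<^sup>2 \<le> s * h y" .
  have "(norm (p - x))\<^sup>2 = s * s * (norm (y - x))\<^sup>2"
    by (simp add: p power_mult_distrib power2_eq_square)
  then have "s * (- (C * (norm (y - x))\<^sup>2) * s) \<le> s * h y" using le by (simp add: mult.commute mult.left_commute)
  then have "- (C * (norm (y - x))\<^sup>2) * s \<le> h y" using s by (simp only: mult_le_cancel_left_pos)
  then show "0 \<le> h y + s * (C * (norm (y - x))\<^sup>2)" by (simp add: algebra_simps)
qed

lemma frechet_subdiff_imp_limiting:
  assumes "u \<in> frechet_subdiff F x" shows "u \<in> limiting_subdiff F x"
proof -
  have "x \<in> effective_dom F" using assms by (auto simp: frechet_subdiff_def split: if_splits)
  moreover have "(\<lambda>_. x) \<longlonglongrightarrow> x \<and> (\<lambda>k. F x) \<longlonglongrightarrow> F x \<and>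
    (\<forall>k::nat. u \<in> frechet_subdiff F x) \<and> (\<lambda>_. u) \<longlonglongrightarrow> u"
    using assms by simp
  ultimately show ?thesis
    unfolding limiting_subdiff_def
    by (simp only: if_True mem_Collect_eq) (rule exI[of _ "\<lambda>_. x"], rule exI[of _ "\<lambda>_. u"])
qed

section \<open>Convergence of the projected gradient iteration for the ratio\<close>

theorem theorem1:
  fixes \<Omega> :: "(real ^ 'n) set"
    and f g ft :: "real ^ 'n \<Rightarrow> real"
    and F :: "real ^ 'n \<Rightarrow> ereal"
    and M Lf Lg \<alpha> :: real
    and x :: "nat \<Rightarrow> real ^ 'n"
    and c :: "nat \<Rightarrow> real"
  assumes Omega: "closed \<Omega>" "convex \<Omega>" "semi_algebraic \<Omega>"
    and convex: "convex_on \<Omega> f" "convex_on \<Omega> g"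
    and semialg: "semi_algebraic_fun_on \<Omega> (\<lambda>z. ereal (f z))"
                 "semi_algebraic_fun_on \<Omega> (\<lambda>z. ereal (g z))"
    and lipschitz: "\<exists>K. K-lipschitz_on \<Omega> f" "\<exists>K. K-lipschitz_on \<Omega> g"
    and diff: "\<forall>z\<in>\<Omega>. f differentiable (at z)" "\<forall>z\<in>\<Omega>. g differentiable (at z)"
    and grad_lipschitz: "Lf-lipschitz_on \<Omega> (grad f)" "Lg-lipschitz_on \<Omega> (grad g)"
    and g_pos: "\<forall>z\<in>\<Omega>. g z > 0"
    and level_bounded: "\<forall>d \<in> {f z / g z | z. z \<in> \<Omega>}. bounded {z \<in> \<Omega>. f z / g z \<le> d}"
    and M: "\<forall>z\<in>\<Omega>. f z - M * g z \<ge> 0"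
    and ft_eq: "ft = (\<lambda>z. f z - M * g z)"
    and F_eq: "F = (\<lambda>z. if z \<in> \<Omega> then ereal (ft z / g z) else \<infinity>)"
    and step: "0 < \<alpha>" "ereal \<alpha> < 1 / ereal (Lf + \<bar>M\<bar> * Lg)"
    and init: "x 0 \<in> \<Omega>"
    and c_eq: "\<forall>k. c k = ft (x k) / g (x k)"
    and PGA: "\<forall>k. x (Suc k) \<in> prox (set_indicator \<Omega>)
                (x k - \<alpha> *\<^sub>R grad ft (x k) + (\<alpha> * c k) *\<^sub>R grad g (x k))"
  shows "\<exists>xstar\<in>\<Omega>. x \<longlonglongrightarrow> xstar \<and> critical_point F xstar \<and>
           (f xstar \<le> 0 \<longrightarrow>
              is_arg_min F (\<lambda>z. z \<in> \<Omega>) xstar \<and>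
              is_arg_min (\<lambda>z. f z / g z) (\<lambda>z. z \<in> \<Omega>) xstar)"
proof -
  define Gt where "Gt z = grad f z - M *\<^sub>R grad g z" for z
  define Lt where "Lt = Lf + \<bar>M\<bar> * Lg"
  have L0: "0 \<le> Lf" "0 \<le> Lg" "0 \<le> Lt"
    using lipschitz_on_nonneg[OF grad_lipschitz(1)] lipschitz_on_nonneg[OF grad_lipschitz(2)]
    by (auto simp: Lt_def)
  have Dg: "GDERIV g z :> grad g z" if "z \<in> \<Omega>" for z
    using diff(2) that by (intro GDERIV_grad) auto
  have Dt: "GDERIV ft z :> Gt z" if "z \<in> \<Omega>" for z
  proof -
    have "GDERIV (\<lambda>z. M * g z) z :> M *\<^sub>R grad g z"
      using GDERIV_mult[OF GDERIV_const Dg[OF that], of M] by simp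
    moreover have "GDERIV f z :> grad f z" using diff(1) that by (intro GDERIV_grad) auto
    ultimately show ?thesis unfolding ft_eq Gt_def by (intro GDERIV_diff)
  qed
  have LGt: "Lt-lipschitz_on \<Omega> Gt"
  proof (rule lipschitz_onI)
    fix y z assume yz: "y \<in> \<Omega>" "z \<in> \<Omega>"
    have "Gt y - Gt z = (grad f y - grad f z) - M *\<^sub>R (grad g y - grad g z)"
      by (simp add: Gt_def algebra_simps)
    then have "norm (Gt y - Gt z) \<le> norm (grad f y - grad f z) + \<bar>M\<bar> * norm (grad g y - grad g z)"
      by (metis norm_triangle_ineq4 norm_scaleR)
    also have "\<dots> \<le> Lf * norm (y - z) + \<bar>M\<bar> * (Lg * norm (y - z))"
      using lipschitz_onD[OF grad_lipschitz(1) yz] lipschitz_onD[OF grad_lipschitz(2) yz]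
      by (intro add_mono mult_left_mono) (simp_all add: dist_norm)
    finally show "dist (Gt y) (Gt z) \<le> Lt * dist y z"
      by (simp add: dist_norm Lt_def algebra_simps)
  qed (rule L0(3))
  have \<alpha>L: "\<alpha> * Lt < 1"
  \<comment> \<open>If \<open>Lt = 0\<close>, the bound \<open>1 / ereal 0\<close> is
    \<open>\<infinity>\<close> and the claim reads \<open>0 < 1\<close>.\<close>
  proof (cases "Lt = 0")
    case False
    then have "0 < Lt" using L0 by simp
    then have "\<alpha> < 1 / Lt" using step(2) by (simp add: Lt_def[symmetric] one_ereal_def)
    then show ?thesis using \<open>0 < Lt\<close> by (simp add: pos_less_divide_eq)
  qed simp
  \<comment> \<open>Per squared step, the projection gains \<open>1 / \<alpha>\<close> and the
    linearisation of \<open>ft\<close> loses at most \<open>Lt\<close>; that of \<open>g\<close>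
    errs in the favourable direction by convexity.\<close>
  define \<beta> where "\<beta> = 1 / \<alpha> - Lt"
  have \<beta>: "0 < \<beta>" using \<alpha>L step(1) by (simp add: \<beta>_def pos_less_divide_eq mult.commute)
  define G where "G k = Gt (x k) - c k *\<^sub>R grad g (x k)" for k
  define d where "d k = x (Suc k) - x k" for k
  have x\<Omega>: "x k \<in> \<Omega>" for k
    by (cases k) (use init prox_set_indicator(1)[OF PGA[rule_format] init] in auto)
  have gx: "0 < g (x k)" for k using g_pos x\<Omega> by blast
  have ftx: "ft (x k) = c k * g (x k)" for k using gx[of k] by (simp add: c_eq)
  have c0: "0 \<le> c k" for k
    using M x\<Omega>[of k] gx[of k] by (simp add: c_eq ft_eq)
  \<comment> \<open>The obtuse angle at the projection, divided by \<open>\<alpha>\<close>: the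
    negative of \<open>G k + (1 / \<alpha>) *\<^sub>R d k\<close> is a normal vector of
    \<open>\<Omega>\<close> at \<open>x (Suc k)\<close>.\<close>
  have opt: "0 \<le> (G k + (1 / \<alpha>) *\<^sub>R d k) \<bullet> (z - x (Suc k))" if z: "z \<in> \<Omega>" for k z
  proof -
    define y where "y = x k - \<alpha> *\<^sub>R grad ft (x k) + (\<alpha> * c k) *\<^sub>R grad g (x k)"
    have y: "y = x k - \<alpha> *\<^sub>R G k"
      using grad_eq[OF Dt[OF x\<Omega>[of k]]] by (simp add: y_def G_def algebra_simps)
    have "x (Suc k) \<in> prox (set_indicator \<Omega>) y" using PGA by (simp add: y_def)
    then have "\<forall>w\<in>\<Omega>. dist y (x (Suc k)) \<le> dist y w" using prox_set_indicator(2) init by blast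
    then have "(y - x (Suc k)) \<bullet> (z - x (Suc k)) \<le> 0"
      by (rule any_closest_point_dot[OF Omega(2,1) x\<Omega> z])
    moreover have "y - x (Suc k) = - (\<alpha> *\<^sub>R (G k + (1 / \<alpha>) *\<^sub>R d k))"
      using step(1) by (simp add: y d_def algebra_simps)
    ultimately have "0 \<le> \<alpha> * ((G k + (1 / \<alpha>) *\<^sub>R d k) \<bullet> (z - x (Suc k)))"
      by (simp only: inner_minus_left inner_scaleR_left neg_le_0_iff_le)
    then show ?thesis using step(1) by (simp only: zero_le_mult_iff) auto
  qed
  have descent: "\<beta> * (norm (d k))\<^sup>2 \<le> (c k - c (Suc k)) * g (x (Suc k))" for k
  proof -
    have "0 \<le> (G k + (1 / \<alpha>) *\<^sub>R d k) \<bullet> (- d k)" using opt[OF x\<Omega>, of k k] by (simp add: d_def)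
    then have 1: "G k \<bullet> d k \<le> - (1 / \<alpha>) * (norm (d k))\<^sup>2"
      by (simp add: inner_add_left power2_norm_eq_inner)
    have 2: "ft (x (Suc k)) \<le> ft (x k) + Gt (x k) \<bullet> d k + Lt * (norm (d k))\<^sup>2"
      using gradient_quadratic_bound[OF Omega(2) x\<Omega>[of k] x\<Omega>[of "Suc k"] Dt LGt] by (simp add: d_def)
    have "g (x k) + grad g (x k) \<bullet> d k \<le> g (x (Suc k))"
      using convex_gradient_bound[OF Omega(2) x\<Omega>[of k] x\<Omega>[of "Suc k"] convex(2) Dg grad_lipschitz(2)]
      by (simp add: d_def)
    then have "c k * (g (x k) + grad g (x k) \<bullet> d k) \<le> c k * g (x (Suc k))"
      using c0 by (rule mult_left_mono)
    then have "c (Suc k) * g (x (Suc k)) - c k * g (x (Suc k)) \<le> G k \<bullet> d k + Lt * (norm (d k))\<^sup>2"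
      using 2 by (simp add: ftx G_def inner_diff_left distrib_left)
    then show ?thesis using 1 by (simp add: \<beta>_def left_diff_distrib)
  qed
  have "decseq c"
  proof (rule decseq_SucI)
    fix k
    have "0 \<le> (c k - c (Suc k)) * g (x (Suc k))"
      using descent[of k] \<beta> order_trans[of 0 "\<beta> * (norm (d k))\<^sup>2"] by simp
    then show "c (Suc k) \<le> c k" using gx[of "Suc k"] by (simp add: zero_le_mult_iff)
  qed
  then have cle: "c k \<le> c 0" for k by (simp add: decseqD)
  \<comment> \<open>Since \<open>f / g\<close> and \<open>F\<close> differ by the constant
    \<open>M\<close> on \<open>\<Omega>\<close>, decrease of \<open>c\<close> keeps the iterates in
    one of the level sets assumed bounded.\<close>
  have ratio: "f z / g z = ft z / g z + M" if "z \<in> \<Omega>" for z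
    using g_pos that by (auto simp: ft_eq diff_divide_distrib)
  have "bounded {z \<in> \<Omega>. f z / g z \<le> f (x 0) / g (x 0)}"
    using level_bounded init by blast
  then obtain R where R: "\<And>z. z \<in> \<Omega> \<Longrightarrow> f z / g z \<le> f (x 0) / g (x 0) \<Longrightarrow> norm z \<le> R"
    unfolding bounded_iff by blast
  have xR: "norm (x k) \<le> R" for k
    by (rule R[OF x\<Omega>]) (use ratio[OF x\<Omega>, of k] ratio[OF init] cle[of k] in \<open>simp add: c_eq\<close>)
  \<comment> \<open>The margin 1 puts every point of \<open>\<Omega>\<close> at distance less than 1
    from the limit into \<open>K\<close>, so an estimate on \<open>K\<close> is a local estimate on
    \<open>\<Omega>\<close>.\<close>
  define K where "K = \<Omega> \<inter> cball 0 (R + 1)"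
  have K\<Omega>: "K \<subseteq> \<Omega>" by (simp add: K_def)
  have cK: "compact K" unfolding K_def using Omega(1) by (intro closed_Int_compact compact_cball)
  have xK: "x k \<in> K" for k using x\<Omega>[of k] xR[of k] by (simp add: K_def)
  have saK: "semialg_pred (\<lambda>z. z \<in> K)"
  proof -
    have "semialg_pred (\<lambda>z. z \<in> \<Omega> \<and> norm z \<le> R + 1)"
      by (intro semialg_intros semialg_mem_semi_algebraic[OF Omega(3)])
    then show ?thesis by (simp add: K_def)
  qed
  have contg: "continuous_on K g" and contf: "continuous_on K f"
    using diff K\<Omega>
    by (auto intro!: continuous_at_imp_continuous_on differentiable_imp_continuous_within)
  \<comment> \<open>A total real function agreeing with \<open>F\<close> on \<open>K\<close>; the
    extensions by zero make it semi-algebraic.\<close>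
  define Q where "Q z = ((if z \<in> K then f z else 0) - M * (if z \<in> K then g z else 0)) /
    (if z \<in> K then g z else 0)" for z
  have saQ: "semialg_fun Q"
    unfolding Q_def[abs_def]
    by (intro semialg_fun_divide semialg_intros semialg_fun_restrict[OF saK K\<Omega>] semialg)
  have Q: "Q z = ft z / g z" if "z \<in> K" for z using that by (simp add: Q_def ft_eq)
  have gK: "0 < g z" if "z \<in> K" for z using g_pos that K\<Omega> by blast
  have contQ: "continuous_on K Q"
  proof -
    have "continuous_on K (\<lambda>z. (f z - M * g z) / g z)"
      by (intro continuous_intros contf contg) (use gK in force)
    then show ?thesis by (rule continuous_on_eq) (simp add: Q ft_eq)
  qed
  have Qx: "Q (x k) = c k" for k using Q[OF xK] by (simp add: c_eq)
  obtain zm where zm: "zm \<in> K" "\<And>z. z \<in> K \<Longrightarrow> g zm \<le> g z"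
    using continuous_attains_inf[OF cK _ contg] xK by blast
  obtain zM where zM: "zM \<in> K" "\<And>z. z \<in> K \<Longrightarrow> g z \<le> g zM"
    using continuous_attains_sup[OF cK _ contg] xK by blast
  define gm where "gm = g zm"
  have gm: "0 < gm" "\<And>z. z \<in> K \<Longrightarrow> gm \<le> g z" using gK zm by (auto simp: gm_def)
  have "bounded (grad g ` K)"
    using lipschitz_on_continuous_on[OF lipschitz_on_subset[OF grad_lipschitz(2) K\<Omega>]] cK
    by (intro compact_imp_bounded compact_continuous_image)
  then obtain Bg where Bg: "\<And>z. z \<in> K \<Longrightarrow> norm (grad g z) \<le> Bg" by (auto simp: bounded_iff)
  have Bg0: "0 \<le> Bg" using Bg[OF xK[of 0]] norm_ge_zero order_trans by blast
  obtain Kf Kg where lip: "Kf-lipschitz_on \<Omega> f" "Kg-lipschitz_on \<Omega> g" using lipschitz by blast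
  have K0: "0 \<le> Kf" "0 \<le> Kg" using lip by (auto dest: lipschitz_on_nonneg)
  define Lc where "Lc = (Kf + \<bar>M\<bar> * Kg + c 0 * Kg) / gm"
  have Lc0: "0 \<le> Lc" using K0 c0 gm(1) by (simp add: Lc_def)
  have clip: "\<bar>c (Suc k) - c k\<bar> \<le> Lc * norm (d k)" for k
  proof -
    define df dg where "df = f (x (Suc k)) - f (x k)" and "dg = g (x (Suc k)) - g (x k)"
    have l: "\<bar>df\<bar> \<le> Kf * norm (d k)" "\<bar>dg\<bar> \<le> Kg * norm (d k)"
      using lipschitz_onD[OF lip(1) x\<Omega>[of "Suc k"] x\<Omega>[of k]] lipschitz_onD[OF lip(2) x\<Omega>[of "Suc k"] x\<Omega>[of k]]
      by (simp_all add: d_def df_def dg_def dist_norm)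
    \<comment> \<open>Multiplication by \<open>g\<close> clears the quotients, so the Lipschitz
      constants of \<open>f\<close> and \<open>g\<close> apply; the lower bound \<open>gm\<close>
      undoes it.\<close>
    have "(c (Suc k) - c k) * g (x (Suc k)) = ft (x (Suc k)) - ft (x k) - c k * dg"
      by (simp add: ftx dg_def algebra_simps)
    also have "\<dots> = df - M * dg - c k * dg" by (simp add: ft_eq df_def dg_def algebra_simps)
    finally have "\<bar>c (Suc k) - c k\<bar> * g (x (Suc k)) = \<bar>df - M * dg - c k * dg\<bar>"
      using gx[of "Suc k"] by (metis abs_mult abs_of_pos)
    also have "\<dots> \<le> \<bar>df\<bar> + \<bar>M * dg\<bar> + \<bar>c k * dg\<bar>" by linarith
    also have "\<dots> = \<bar>df\<bar> + \<bar>M\<bar> * \<bar>dg\<bar> + c k * \<bar>dg\<bar>" using c0 by (simp add: abs_mult)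
    also have "\<dots> \<le> Kf * norm (d k) + \<bar>M\<bar> * (Kg * norm (d k)) + c 0 * (Kg * norm (d k))"
      using l c0 cle by (intro add_mono mult_left_mono mult_mono) auto
    also have "\<dots> = gm * (Lc * norm (d k))" using gm(1) by (simp add: Lc_def field_simps)
    finally have *: "\<bar>c (Suc k) - c k\<bar> * g (x (Suc k)) \<le> gm * (Lc * norm (d k))" .
    have "gm * \<bar>c (Suc k) - c k\<bar> \<le> \<bar>c (Suc k) - c k\<bar> * g (x (Suc k))"
      using mult_right_mono[OF gm(2)[OF xK[of "Suc k"]] abs_ge_zero[of "c (Suc k) - c k"]]
      by (simp add: mult.commute)
    then have "gm * \<bar>c (Suc k) - c k\<bar> \<le> gm * (Lc * norm (d k))" using * by linarith
    then show ?thesis using gm(1) by simp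
  qed
  \<comment> \<open>The numerator of \<open>b\<close> collects the four parts of
    \<open>norm e\<close> per unit step: the changes of \<open>Gt\<close>, of \<open>grad g\<close>
    and of \<open>c\<close>, and the proximal term. That of \<open>C\<close> collects the quadratic
    errors of \<open>ft\<close> and of \<open>c (Suc k)\<close> times \<open>g\<close>.\<close>
  define b where "b = (Lt + c 0 * Lg + Lc * Bg + 1 / \<alpha>) / gm"
  define C where "C = (Lt + c 0 * Lg) / gm"
  have b0: "0 \<le> b" using L0 c0 Lc0 Bg0 step(1) gm(1) by (simp add: b_def)
  have C0: "0 \<le> C" using L0 c0 gm(1) by (simp add: C_def)
  have steep: "steepness C K Q (x (Suc k)) (b * norm (d k))" for k
  proof -
    \<comment> \<open>\<open>G (Suc k)\<close> is the gradient of \<open>ft - c (Suc k) * g\<close>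
      at the new point. Subtracting the vector of \<open>opt\<close>, which is nonnegative on
      feasible directions, leaves a remainder of the order of the step.\<close>
    define e where "e = G (Suc k) - (G k + (1 / \<alpha>) *\<^sub>R d k)"
    have "e = (Gt (x (Suc k)) - Gt (x k)) - c k *\<^sub>R (grad g (x (Suc k)) - grad g (x k))
        - (c (Suc k) - c k) *\<^sub>R grad g (x (Suc k)) - (1 / \<alpha>) *\<^sub>R d k"
      by (simp add: e_def G_def algebra_simps)
    then have "norm e \<le> norm (Gt (x (Suc k)) - Gt (x k)) + norm (c k *\<^sub>R (grad g (x (Suc k)) - grad g (x k)))
        + norm ((c (Suc k) - c k) *\<^sub>R grad g (x (Suc k))) + norm ((1 / \<alpha>) *\<^sub>R d k)"
      by (simp only:) (intro order_trans[OF norm_triangle_ineq4] add_right_mono norm_triangle_ineq4)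
    also have "\<dots> = norm (Gt (x (Suc k)) - Gt (x k)) + c k * norm (grad g (x (Suc k)) - grad g (x k))
        + \<bar>c (Suc k) - c k\<bar> * norm (grad g (x (Suc k))) + 1 / \<alpha> * norm (d k)"
      using c0 step(1) by simp
    also have "\<dots> \<le> Lt * norm (d k) + c 0 * (Lg * norm (d k)) + (Lc * norm (d k)) * Bg + 1 / \<alpha> * norm (d k)"
    proof (intro add_mono mult_mono order_refl)
      show "norm (Gt (x (Suc k)) - Gt (x k)) \<le> Lt * norm (d k)"
        using lipschitz_onD[OF LGt x\<Omega>[of "Suc k"] x\<Omega>[of k]] by (simp add: d_def dist_norm)
      show "norm (grad g (x (Suc k)) - grad g (x k)) \<le> Lg * norm (d k)"
        using lipschitz_onD[OF grad_lipschitz(2) x\<Omega>[of "Suc k"] x\<Omega>[of k]] by (simp add: d_def dist_norm)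
    qed (use c0 cle clip Bg[OF xK] Lc0 step(1) in auto)
    also have "\<dots> = gm * (b * norm (d k))" using gm(1) by (simp add: b_def field_simps)
    finally have e: "norm e \<le> gm * (b * norm (d k))" .
    have "Q (x (Suc k)) - Q y \<le> b * norm (d k) * norm (y - x (Suc k)) + C * (norm (y - x (Suc k)) * norm (y - x (Suc k)))"
      if y: "y \<in> K" for y
    proof -
      have y\<Omega>: "y \<in> \<Omega>" using y K\<Omega> by blast
      define v where "v = y - x (Suc k)"
      define n where "n = norm v"
      have n0: "0 \<le> n" by (simp add: n_def)
      have 1: "ft (x (Suc k)) + Gt (x (Suc k)) \<bullet> v - Lt * n\<^sup>2 \<le> ft y"
        using gradient_quadratic_bound[OF Omega(2) x\<Omega>[of "Suc k"] y\<Omega> Dt LGt] by (simp add: v_def n_def)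
      have "g y \<le> g (x (Suc k)) + grad g (x (Suc k)) \<bullet> v + Lg * n\<^sup>2"
        using gradient_quadratic_bound[OF Omega(2) x\<Omega>[of "Suc k"] y\<Omega> Dg grad_lipschitz(2)]
        by (simp add: v_def n_def)
      then have 2: "c (Suc k) * g y \<le> c (Suc k) * (g (x (Suc k)) + grad g (x (Suc k)) \<bullet> v + Lg * n\<^sup>2)"
        using c0 by (rule mult_left_mono)
      have "c (Suc k) * (Lg * n\<^sup>2) \<le> c 0 * (Lg * n\<^sup>2)"
        using cle L0 by (intro mult_right_mono) auto
      then have 3: "c (Suc k) * g y - ft y \<le> - (G (Suc k) \<bullet> v) + (Lt + c 0 * Lg) * n\<^sup>2"
        using 1 2 by (simp add: ftx G_def inner_diff_left algebra_simps)
      have "G (Suc k) = e + (G k + (1 / \<alpha>) *\<^sub>R d k)" by (simp add: e_def)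
      then have "e \<bullet> v \<le> G (Suc k) \<bullet> v" using opt[OF y\<Omega>, of k] by (simp add: v_def inner_add_left)
      moreover have "- (norm e * n) \<le> e \<bullet> v"
        using Cauchy_Schwarz_ineq2[of e v] by (simp add: n_def)
      ultimately have "c (Suc k) * g y - ft y \<le> norm e * n + (Lt + c 0 * Lg) * n\<^sup>2" using 3 by linarith
      also have "\<dots> \<le> gm * (b * norm (d k)) * n + gm * C * n\<^sup>2"
        using mult_right_mono[OF e n0] gm(1) by (simp add: C_def)
      also have "\<dots> = gm * (b * norm (d k) * n + C * (n * n))" by (simp add: power2_eq_square algebra_simps)
      also have "\<dots> \<le> g y * (b * norm (d k) * n + C * (n * n))"
        using gm(2)[OF y] b0 C0 n0 by (intro mult_right_mono) auto
      finally have "(c (Suc k) * g y - ft y) / g y \<le> b * norm (d k) * n + C * (n * n)"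
        using gK[OF y] by (simp only: pos_divide_le_eq mult.commute[of _ "g y"])
      moreover have "(c (Suc k) * g y - ft y) / g y = c (Suc k) - ft y / g y"
        using gK[OF y] by (simp add: diff_divide_distrib)
      ultimately have "c (Suc k) - ft y / g y \<le> b * norm (d k) * n + C * (n * n)" by simp
      then show ?thesis by (simp add: Qx Q[OF y] n_def v_def)
    qed
    then show ?thesis using xK b0 by (simp add: steepness_def)
  qed
  \<comment> \<open>The decrease is weighted by \<open>g\<close> at the new iterate; the maximum of
    \<open>g\<close> over \<open>K\<close> gives a uniform constant.\<close>
  have dec: "\<beta> / g zM * (norm (x (Suc k) - x k))\<^sup>2 \<le> Q (x k) - Q (x (Suc k))" for k
  proof -
    have "(c k - c (Suc k)) * g (x (Suc k)) \<le> (c k - c (Suc k)) * g zM"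
      using zM(2)[OF xK] decseq_SucD[OF \<open>decseq c\<close>] by (intro mult_left_mono) auto
    then have "\<beta> * (norm (d k))\<^sup>2 \<le> (c k - c (Suc k)) * g zM" using descent[of k] by linarith
    then show ?thesis using gK[OF zM(1)] by (simp add: Qx d_def field_simps)
  qed
  have "convergent x"
  proof (rule steepness_descent_convergent[OF cK saK saQ contQ])
    show "0 < \<beta> / g zM" using \<beta> gK[OF zM(1)] by simp
    show "steepness C K Q (x (Suc k)) (b * norm (x (Suc k) - x k))" for k
      using steep[of k] by (simp add: d_def)
  qed (rule xK dec b0)+
  then obtain xs where lim: "x \<longlonglongrightarrow> xs" by (auto simp: convergent_def)
  have xsK: "xs \<in> K" using compact_imp_closed[OF cK] xK lim by (metis closed_sequentially)
  have xs\<Omega>: "xs \<in> \<Omega>" using xsK K\<Omega> by blast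
  have xsR: "norm xs \<le> R"
    by (rule tendsto_upperbound[OF tendsto_norm[OF lim]]) (simp_all add: xR)
  \<comment> \<open>Since the steps tend to 0, the linear term of the steepness inequality
    disappears in the limit and only the quadratic one remains.\<close>
  have quad: "Q xs - Q y \<le> C * (norm (y - xs))\<^sup>2" if y: "y \<in> K" for y
  proof -
    have limS: "(\<lambda>k. x (Suc k)) \<longlonglongrightarrow> xs" using lim by (rule LIMSEQ_Suc)
    have "(\<lambda>k. Q (x (Suc k))) \<longlonglongrightarrow> Q xs"
      by (rule continuous_on_tendsto_compose[OF contQ limS xsK]) (simp add: xK)
    moreover have "d \<longlonglongrightarrow> xs - xs"
      unfolding d_def[abs_def] by (intro tendsto_intros lim limS)
    ultimately have "(\<lambda>k. b * norm (d k) * norm (y - x (Suc k)) + C * (norm (y - x (Suc k)) * norm (y - x (Suc k)))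
        - (Q (x (Suc k)) - Q y)) \<longlonglongrightarrow>
        b * norm (xs - xs) * norm (y - xs) + C * (norm (y - xs) * norm (y - xs)) - (Q xs - Q y)"
      by (intro tendsto_intros limS)
    then have "0 \<le> b * norm (xs - xs) * norm (y - xs) + C * (norm (y - xs) * norm (y - xs)) - (Q xs - Q y)"
      by (rule tendsto_lowerbound) (use steep y in \<open>auto simp: steepness_def\<close>)
    then show ?thesis by (simp add: power2_eq_square)
  qed
  have near: "y \<in> K" if "y \<in> \<Omega>" "dist y xs < 1" for y
    using that xsR norm_triangle_sub[of y xs] by (auto simp: K_def dist_norm)
  have "0 \<in> frechet_subdiff F xs"
  proof (rule frechet_subdiff_0I[of 1])
    show "F xs = ereal (Q xs)" using xs\<Omega> xsK by (simp add: F_eq Q)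
    show "\<exists>b. F y = ereal b \<and> Q xs - b \<le> C * (norm (y - xs))\<^sup>2" if y: "dist y xs < 1" "F y \<noteq> \<infinity>" for y
    proof -
      have "y \<in> \<Omega>" using y(2) by (simp add: F_eq split: if_splits)
      then have "y \<in> K" using near y(1) by blast
      then show ?thesis using quad[of y] \<open>y \<in> \<Omega>\<close> by (simp add: F_eq Q)
    qed
  qed simp
  then have crit: "critical_point F xs"
    unfolding critical_point_def by (rule frechet_subdiff_imp_limiting)
  have glob: "f xs / g xs \<le> f z / g z" if neg: "f xs \<le> 0" and z: "z \<in> \<Omega>" for z
  proof -
    define l where "l = f xs / g xs"
    have l: "l \<le> 0" "l = Q xs + M"
      using divide_nonpos_pos[OF neg gK[OF xsK]] ratio[OF xs\<Omega>] Q[OF xsK] by (simp_all add: l_def)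
    have "convex_on \<Omega> (\<lambda>z. f z + (- l) * g z)"
      using l(1) by (intro convex_on_add convex convex_on_cmul) auto
    then have cv: "convex_on \<Omega> (\<lambda>z. f z - l * g z)" by simp
    have "0 \<le> f z - l * g z"
    \<comment> \<open>The constant arises from \<open>quad\<close>, an estimate for the ratio, on
      multiplication by \<open>g y \<le> g zM\<close>.\<close>
    proof (rule convex_local_quadratic_min[OF cv Omega(2) xs\<Omega> z, of 1 "C * g zM"])
      show "f xs - l * g xs = 0" using g_pos xs\<Omega> by (auto simp: l_def)
      show "- (C * g zM) * (norm (y - xs))\<^sup>2 \<le> f y - l * g y" if y: "y \<in> \<Omega>" "dist y xs < 1" for y
      proof -
        have yK: "y \<in> K" using near y by blast
        have "(l - f y / g y) * g y \<le> (C * (norm (y - xs))\<^sup>2) * g y"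
          using quad[OF yK] ratio[OF y(1)] Q[OF yK] l(2) gK[OF yK] by (intro mult_right_mono) auto
        also have "\<dots> \<le> (C * (norm (y - xs))\<^sup>2) * g zM"
          using zM(2)[OF yK] C0 by (intro mult_left_mono) auto
        finally have "(l - f y / g y) * g y \<le> (C * g zM) * (norm (y - xs))\<^sup>2"
          by (simp only: mult.assoc mult.commute[of _ "g zM"])
        moreover have "(l - f y / g y) * g y = l * g y - f y"
          using gK[OF yK] by (simp add: left_diff_distrib)
        ultimately show ?thesis by simp
      qed
    qed simp
    then show ?thesis using g_pos z by (simp add: l_def[symmetric] pos_le_divide_eq)
  qed
  have "is_arg_min F (\<lambda>z. z \<in> \<Omega>) xs \<and> is_arg_min (\<lambda>z. f z / g z) (\<lambda>z. z \<in> \<Omega>) xs" if neg: "f xs \<le> 0"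
  proof -
    have "ft xs / g xs \<le> ft z / g z" if z: "z \<in> \<Omega>" for z
      using glob[OF neg z] ratio[OF z] ratio[OF xs\<Omega>] by simp
    then show ?thesis using glob[OF neg] xs\<Omega> by (auto simp: is_arg_min_def F_eq not_less)
  qed
  then show ?thesis using xs\<Omega> lim crit by blast
qed

end
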